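(* Let $k=\begin{pmatrix}A&B\\C&D\end{pmatrix}\in SU(p,q)$ with $\det(k+I_n)\neq 0$. Let $\tilde k$, $M$ and the blocks $\alpha,\beta,\gamma$ of $M^{-1}$ be the matrices associated with $k$ in the context. Then, for each $z\in\mathbb{C}^n$, $$W(\sigma(k))(z)=2^n\,|\det(k+I_n)|^{-1}\exp\left(\lambda\begin{pmatrix}z&\bar z\end{pmatrix}\begin{pmatrix}\gamma&\tfrac12 I_n-\beta^t\\ \tfrac12 I_n-\beta&\alpha\end{pmatrix}\begin{pmatrix}z\\ \bar z\end{pmatrix}\right)$$ $$=2^n\,|\det(k+I_n)|^{-1}\exp\left(\tfrac{\lambda}{2}\begin{pmatrix}z&\bar z\end{pmatrix}J(\tilde k+I_{2n})^{-1}(\tilde k-I_{2n})\begin{pmatrix}z\\ \bar z\end{pmatrix}\right).$$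
   Context: Let $p,q$ be positive integers, $n=p+q$, and fix $\lambda>0$. For $u,v\in\mathbb{C}^m$ write $uv=\sum_j u_jv_j$ (no conjugation) and $|u|^2=u\bar u$; matrices act on vectors in the usual way (a matrix $N$ applied to $u$, written $Nu$). $N^t$ is the transpose, $N^\star$ the conjugate transpose, $\overline N$ the entrywise conjugate. For $z\in\mathbb{C}^n$, $\begin{pmatrix}z&\bar z\end{pmatrix}$ is a row vector of length $2n$ and $\begin{pmatrix}z\\ \bar z\end{pmatrix}$ the corresponding column vector. $SU(p,q)$ is the group of $k\in SL(n,\mathbb{C})$ with $kJ_0k^\star=J_0$, $J_0=\begin{pmatrix}I_p&0\\0&-I_q\end{pmatrix}$; its elements are written as block matrices $\begin{pmatrix}A&B\\C&D\end{pmatrix}$ with blocks of sizes $p\times p$, $p\times q$, $q\times p$, $q\times q$ ($A$ and $D$ are then invertible). Fock space: $\mathcal{F}$ is the Hilbert space of holomorphic functions $f$ on $\mathbb{C}^n$ with $\|f\|^2=\left(\tfrac{\lambda}{2\pi}\right)^n\int_{\mathbb{C}^n}|f(z)|^2e^{-\lambda|z|^2/2}\,dm(z)<\infty$, $dm$ being Lebesgue measure on $\mathbb{C}^n$. Put $dm_\lambda=\left(\tfrac{\lambda}{2\pi}\right)^n dm$ and $e_z(w)=\exp(\lambda\bar z w/2)$, so that $f(z)=\langle f,e_z\rangle$. The kernel of an operator $T$ on $\mathcal{F}$ is $k_T(z,w)=\langle Te_w,e_z\rangle$, i.e. $(Tf)(z)=\int k_T(z,w)f(w)e^{-\lambda|w|^2/2}dm_\lambda(w)$.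 Complex Weyl symbol: $W(T)$ is the function on $\mathbb{C}^n$ defined by $$W(T)(z)=2^n\int_{\mathbb{C}^n}k_T(z+w,z-w)\exp\left(\tfrac{\lambda}{2}(-z\bar z-w\bar w+z\bar w-\bar zw)\right)dm_\lambda(w).$$ Harmonic representation: $\sigma$ is the unitary representation of $SU(p,q)$ on $\mathcal{F}$ such that for $k=\begin{pmatrix}A&B\\C&D\end{pmatrix}$ the operator $\sigma(k)$ has kernel $$b_k(z,w)=(\det A)^{-1}\exp\tfrac{\lambda}{2}\left(-(\overline D^{-1}\overline C\bar w_1)\bar w_2+(\overline D^{-1}z_2)\bar w_2+(A^{-1}z_1)\bar w_1+z_1(\overline B\,\overline D^{-1}z_2)\right),$$ where $z=(z_1,z_2)$, $w=(w_1,w_2)$, $z_1,w_1\in\mathbb{C}^p$, $z_2,w_2\in\mathbb{C}^q$. Matrices attached to $k$: $J=\begin{pmatrix}0&I_n\\-I_n&0\end{pmatrix}$, $P=\begin{pmatrix}A&0\\0&\overline D\end{pmatrix}$, $Q=\begin{pmatrix}0&B\\ \overline C&0\end{pmatrix}$, $\tilde k=\begin{pmatrix}P&Q\\ \overline Q&\overline P\end{pmatrix}$, $$R=\begin{pmatrix}0&-\overline B\,\overline D^{-1}\\-(D^\star)^{-1}B^\star&0\end{pmatrix},\quad S=\begin{pmatrix}I_p+(A^t)^{-1}&0\\0&I_q+(D^\star)^{-1}\end{pmatrix},\quad T=\begin{pmatrix}0&C^\star(D^\star)^{-1}\\ \overline D^{-1}\overline C&0\end{pmatrix},$$ $M=\begin{pmatrix}R&S\\S^t&T\end{pmatrix}$,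 which is invertible when $\det(k+I_n)\ne0$; then write $M^{-1}=\begin{pmatrix}\alpha&\beta\\ \beta^t&\gamma\end{pmatrix}$ with $n\times n$ blocks. The matrix $\tilde k+I_{2n}$ is then also invertible.
   Formalization: The prefactor |det(k+I_n)|^{-1} is replaced by det(k+I_n)^{-1}: det(k+I_n) is real on SU(p,q) but may be negative, and then the printed sign is wrong (p=2, q=1, k=e^{2πi/3}I_3 gives W(σ(k))(0)=-8, not 8). *)

theory Defs
  imports "HOL-Analysis.Analysis"
begin

(* C^n with n = p + q is complex ^ ('p + 'q), where p = CARD('p) and q = CARD('q); both are
   positive because types are nonempty. Row indices are Inl i (first p) and Inr j (last q). *)

definition cdot :: "complex ^ 'n \<Rightarrow> complex ^ 'n \<Rightarrow> complex"
  where "cdot u v = (\<Sum>j\<in>UNIV. u $ j * v $ j)"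

definition vcnj :: "complex ^ 'n \<Rightarrow> complex ^ 'n"
  where "vcnj u = (\<chi> i. cnj (u $ i))"

definition mcnj :: "complex ^ 'n ^ 'm \<Rightarrow> complex ^ 'n ^ 'm"
  where "mcnj N = (\<chi> i j. cnj (N $ i $ j))"

definition cadj :: "complex ^ 'n ^ 'm \<Rightarrow> complex ^ 'm ^ 'n"
  where "cadj N = mcnj (transpose N)"

definition vfst :: "'a ^ ('p::finite + 'q::finite) \<Rightarrow> 'a ^ 'p"
  where "vfst z = (\<chi> i. z $ Inl i)"

definition vsnd :: "'a ^ ('p::finite + 'q::finite) \<Rightarrow> 'a ^ 'q"
  where "vsnd z = (\<chi> i. z $ Inr i)"

definition vjoin :: "'a ^ 'p \<Rightarrow> 'a ^ 'q \<Rightarrow> 'a ^ ('p::finite + 'q::finite)"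
  where "vjoin u v = (\<chi> i. case i of Inl a \<Rightarrow> u $ a | Inr b \<Rightarrow> v $ b)"

definition block ::
  "'a ^ 'c ^ 'r \<Rightarrow> 'a ^ 'd ^ 'r \<Rightarrow> 'a ^ 'c ^ 's \<Rightarrow> 'a ^ 'd ^ 's \<Rightarrow> 'a ^ ('c::finite + 'd::finite) ^ ('r::finite + 's::finite)"
  where "block A B C D = (\<chi> i. case i of Inl a \<Rightarrow> vjoin (A $ a) (B $ a) | Inr b \<Rightarrow> vjoin (C $ b) (D $ b))"

definition blk11 :: "'a ^ ('c::finite + 'd::finite) ^ ('r::finite + 's::finite) \<Rightarrow> 'a ^ 'c ^ 'r"
  where "blk11 N = (\<chi> i j. N $ Inl i $ Inl j)"

definition blk12 :: "'a ^ ('c::finite + 'd::finite) ^ ('r::finite + 's::finite) \<Rightarrow> 'a ^ 'd ^ 'r"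
  where "blk12 N = (\<chi> i j. N $ Inl i $ Inr j)"

definition blk21 :: "'a ^ ('c::finite + 'd::finite) ^ ('r::finite + 's::finite) \<Rightarrow> 'a ^ 'c ^ 's"
  where "blk21 N = (\<chi> i j. N $ Inr i $ Inl j)"

definition blk22 :: "'a ^ ('c::finite + 'd::finite) ^ ('r::finite + 's::finite) \<Rightarrow> 'a ^ 'd ^ 's"
  where "blk22 N = (\<chi> i j. N $ Inr i $ Inr j)"

definition J0 :: "complex ^ ('p::finite + 'q::finite) ^ ('p + 'q)"
  where "J0 = block (mat 1) 0 0 (- mat 1)"

definition SU :: "(complex ^ ('p::finite + 'q::finite) ^ ('p + 'q)) set"
  where "SU = {k. det k = 1 \<and> k ** J0 ** cadj k = J0}"

definition holomorphic_vec :: "(complex ^ 'n \<Rightarrow> complex) \<Rightarrow> bool"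
  where "holomorphic_vec f \<longleftrightarrow>
    (\<forall>z. \<exists>D. (f has_derivative D) (at z) \<and> (\<forall>c v. D (c *s v) = c * D v))"

definition dm :: "real \<Rightarrow> (complex ^ 'n) measure"
  where "dm lam = density lborel (\<lambda>_. ennreal ((lam / (2 * pi)) ^ CARD('n)))"

definition fock :: "real \<Rightarrow> (complex ^ 'n \<Rightarrow> complex) set"
  where "fock lam = {f. holomorphic_vec f \<and>
    integrable (dm lam) (\<lambda>z. (cmod (f z))\<^sup>2 * exp (- lam * (norm z)\<^sup>2 / 2))}"

definition fock_inner :: "real \<Rightarrow> (complex ^ 'n \<Rightarrow> complex) \<Rightarrow> (complex ^ 'n \<Rightarrow> complex) \<Rightarrow> complex"
  where "fock_inner lam f g =
    (\<integral>z. f z * cnj (g z) * of_real (exp (- lam * (norm z)\<^sup>2 / 2)) \<partial>dm lam)"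

definition coherent :: "real \<Rightarrow> complex ^ 'n \<Rightarrow> complex ^ 'n \<Rightarrow> complex"
  where "coherent lam z = (\<lambda>w. exp (of_real lam * cdot (vcnj z) w / 2))"

definition op_kernel ::
  "real \<Rightarrow> ((complex ^ 'n \<Rightarrow> complex) \<Rightarrow> (complex ^ 'n \<Rightarrow> complex)) \<Rightarrow>
   complex ^ 'n \<Rightarrow> complex ^ 'n \<Rightarrow> complex"
  where "op_kernel lam T z w = fock_inner lam (T (coherent lam w)) (coherent lam z)"

definition weyl ::
  "real \<Rightarrow> ((complex ^ 'n \<Rightarrow> complex) \<Rightarrow> (complex ^ 'n \<Rightarrow> complex)) \<Rightarrow> complex ^ 'n \<Rightarrow> complex"
  where "weyl lam T z = 2 ^ CARD('n) *
    (\<integral>w. op_kernel lam T (z + w) (z - w) *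
       exp (of_real lam / 2 *
         (- cdot z (vcnj z) - cdot w (vcnj w) + cdot z (vcnj w) - cdot (vcnj z) w)) \<partial>dm lam)"

definition harmonic_kernel ::
  "real \<Rightarrow> complex ^ ('p::finite + 'q::finite) ^ ('p + 'q) \<Rightarrow> complex ^ ('p + 'q) \<Rightarrow> complex ^ ('p + 'q) \<Rightarrow> complex"
  where "harmonic_kernel lam k z w =
    (let A = blk11 k; B = blk12 k; C = blk21 k; D = blk22 k;
         z1 = vfst z; z2 = vsnd z; w1 = vfst w; w2 = vsnd w
     in inverse (det A) *
        exp (of_real lam / 2 *
          (- cdot (matrix_inv (mcnj D) *v (mcnj C *v vcnj w1)) (vcnj w2)
           + cdot (matrix_inv (mcnj D) *v z2) (vcnj w2)
           + cdot (matrix_inv A *v z1) (vcnj w1)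
           + cdot z1 (mcnj B *v (matrix_inv (mcnj D) *v z2)))))"

(* An operator on Fock space is determined by its kernel, so sigma(k) is given here directly as
   the integral operator on Fock space with kernel harmonic_kernel; it is undefined off Fock
   space. That its kernel in the sense of op_kernel is harmonic_kernel, and that k |-> sigma(k)
   is a unitary representation of SU(p,q), are consequences and not built in. *)
definition harmonic_rep ::
  "real \<Rightarrow> complex ^ ('p::finite + 'q::finite) ^ ('p + 'q) \<Rightarrow>
   (complex ^ ('p + 'q) \<Rightarrow> complex) \<Rightarrow> (complex ^ ('p + 'q) \<Rightarrow> complex)"
  where "harmonic_rep lam k = (\<lambda>f\<in>fock lam. (\<lambda>z.
    \<integral>w. harmonic_kernel lam k z w * f w * of_real (exp (- lam * (norm w)\<^sup>2 / 2)) \<partial>dm lam))"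

definition symp_J :: "complex ^ ('n::finite + 'n) ^ ('n + 'n)"
  where "symp_J = block 0 (mat 1) (- mat 1) 0"

definition P_mat :: "complex ^ ('p::finite + 'q::finite) ^ ('p + 'q) \<Rightarrow> complex ^ ('p + 'q) ^ ('p + 'q)"
  where "P_mat k = block (blk11 k) 0 0 (mcnj (blk22 k))"

definition Q_mat :: "complex ^ ('p::finite + 'q::finite) ^ ('p + 'q) \<Rightarrow> complex ^ ('p + 'q) ^ ('p + 'q)"
  where "Q_mat k = block 0 (blk12 k) (mcnj (blk21 k)) 0"

definition k_tilde ::
  "complex ^ ('p::finite + 'q::finite) ^ ('p + 'q) \<Rightarrow>
   complex ^ (('p + 'q) + ('p + 'q)) ^ (('p + 'q) + ('p + 'q))"
  where "k_tilde k = block (P_mat k) (Q_mat k) (mcnj (Q_mat k)) (mcnj (P_mat k))"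

definition R_mat :: "complex ^ ('p::finite + 'q::finite) ^ ('p + 'q) \<Rightarrow> complex ^ ('p + 'q) ^ ('p + 'q)"
  where "R_mat k =
    (let B = blk12 k; D = blk22 k
     in block 0 (- (mcnj B ** matrix_inv (mcnj D))) (- (matrix_inv (cadj D) ** cadj B)) 0)"

definition S_mat :: "complex ^ ('p::finite + 'q::finite) ^ ('p + 'q) \<Rightarrow> complex ^ ('p + 'q) ^ ('p + 'q)"
  where "S_mat k =
    (let A = blk11 k; D = blk22 k
     in block (mat 1 + matrix_inv (transpose A)) 0 0 (mat 1 + matrix_inv (cadj D)))"

definition T_mat :: "complex ^ ('p::finite + 'q::finite) ^ ('p + 'q) \<Rightarrow> complex ^ ('p + 'q) ^ ('p + 'q)"
  where "T_mat k =
    (let C = blk21 k; D = blk22 k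
     in block 0 (cadj C ** matrix_inv (cadj D)) (matrix_inv (mcnj D) ** mcnj C) 0)"

definition M_mat ::
  "complex ^ ('p::finite + 'q::finite) ^ ('p + 'q) \<Rightarrow>
   complex ^ (('p + 'q) + ('p + 'q)) ^ (('p + 'q) + ('p + 'q))"
  where "M_mat k = block (R_mat k) (S_mat k) (transpose (S_mat k)) (T_mat k)"

(* M is symmetric, so the lower left block of its inverse is the transpose of the upper right
   block beta. *)
definition alpha_mat :: "complex ^ ('p::finite + 'q::finite) ^ ('p + 'q) \<Rightarrow> complex ^ ('p + 'q) ^ ('p + 'q)"
  where "alpha_mat k = blk11 (matrix_inv (M_mat k))"

definition beta_mat :: "complex ^ ('p::finite + 'q::finite) ^ ('p + 'q) \<Rightarrow> complex ^ ('p + 'q) ^ ('p + 'q)"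
  where "beta_mat k = blk12 (matrix_inv (M_mat k))"

definition gamma_mat :: "complex ^ ('p::finite + 'q::finite) ^ ('p + 'q) \<Rightarrow> complex ^ ('p + 'q) ^ ('p + 'q)"
  where "gamma_mat k = blk22 (matrix_inv (M_mat k))"

(* Pitfall on the prefactor of the Weyl symbol of sigma(k): det (k + I) is real on SU(p,q) but it
   can be negative, and the prefactor carries that sign, i.e. it is 2^n det(k + I)^(-1), which
   is 2^n |det(k + I)|^(-1) only when det (k + I) > 0. For p = 2, q = 1 and k = exp(2 pi i/3) I,
   det (k + I) = -1 and the symbol at 0 is -8. *)

end

theory Submission
  imports Defs "HOL-Probability.Characteristic_Functions" "HOL-Complex_Analysis.Conformal_Mappings"
begin

text \<open>The matrices \<open>H\<close> are not Hermitian, and the unipotent ones met on the way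
  are in general not even diagonalisable. So a Gaussian integral is evaluated by eliminating one
  complex coordinate at a time, with Schur complements as the remaining matrices; analytic
  continuation in a complex coefficient is confined to the real line. The operator is given as an
  integral operator, whereas the Weyl symbol is built from the inner products <T e_w, e_z>. Two
  auxiliary Gaussian integrals with unipotent \<open>H\<close> show that these inner products return
  the harmonic kernel. With \<zeta> = (z1, cnj z2), the vector \<sigma> = (k + 1)^-1 \<zeta> is the
  natural unknown: the system \<open>H x = b\<close> of the Weyl integral is solved by x = \<zeta> -
  2 \<sigma> = (k - 1) (k + 1)^-1 \<zeta>, the Cayley transform of k applied to \<zeta>. Moreover
  (z, cnj z) and (- cnj z, z) have preimages explicit in \<sigma> under \<open>k_tilde + 1\<close>
  and under \<open>M\<close>. Hence neither of these two inverses is computed; both closed forms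
  meet in one antisymmetric pairing of z with \<sigma>.\<close>

text \<open>
  In the coordinates \<open>u = (w\<^sub>1, cnj w\<^sub>2)\<close> every Gaussian integral in sight has a sesquilinear
  exponent \<open>- cnj u \<bullet> H u + a \<bullet> u + b \<bullet> cnj u\<close>, so that its value is
  \<open>exp (a \<bullet> H\<^sup>-\<^sup>1 b) / det H\<close> up to normalisation: the determinant enters without a square root and
  there is no branch to choose. The harmonic kernel is governed by the Potapov--Ginzburg transform
  \<open>U\<close> of \<open>k\<close>, which is unitary because \<open>k\<close> preserves the indefinite form. For the Weyl symbol,
  \<open>H = 1 + K U K\<close> with \<open>K = diag (1, -1)\<close>; unitarity gives \<open>2 Re (cnj u \<bullet> H u) = |H u|\<^sup>2\<close>, hence
  convergence as soon as \<open>H\<close> is invertible, and a block factorisation gives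
  \<open>det A * det H = det (k + 1)\<close>. All exponents are expressed through the solution \<open>\<sigma>\<close> of
  \<open>k \<sigma> + \<sigma> = (z\<^sub>1, cnj z\<^sub>2)\<close>.
\<close>

unbundle no fps_syntax

section \<open>Gaussian integrals on the line and the plane\<close>

text \<open>This is the characteristic function of the standard normal law, multiplied by sqrt (2
  pi) to remove the normalisation of the density.\<close>

lemma has_bochner_integral_std_gaussian_iexp:
  fixes t :: real
  shows "has_bochner_integral lborel (\<lambda>y::real. exp (of_real (- y\<^sup>2 / 2) + \<i> * of_real (t * y)))
           (of_real (sqrt (2 * pi)) * exp (- (of_real t)\<^sup>2 / 2))"
proof -
  have int: "integrable (density lborel std_normal_density) (\<lambda>x. iexp (t * x))"
    by (intro finite_measure.integrable_const_bound[where B = 1] prob_space.finite_measure prob_space_normal_density) auto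
  have "(\<integral>x. std_normal_density x *\<^sub>R iexp (t * x) \<partial>lborel)
      = (\<integral>x. iexp (t * x) \<partial>density lborel std_normal_density)"
    by (subst integral_density) auto
  also have "\<dots> = complex_of_real (exp (- (t^2) / 2))"
    using char_std_normal_distribution[THEN fun_cong, of t] by (simp add: char_def)
  finally have val: "(\<integral>x. std_normal_density x *\<^sub>R iexp (t * x) \<partial>lborel) = complex_of_real (exp (- (t^2) / 2))" .
  have int': "integrable lborel (\<lambda>x. std_normal_density x *\<^sub>R iexp (t * x))"
    using int by (subst (asm) integrable_density) auto
  have "has_bochner_integral lborel (\<lambda>x. std_normal_density x *\<^sub>R iexp (t * x)) (complex_of_real (exp (- (t^2) / 2)))"
    using val int' by (simp add: has_bochner_integral_iff)
  then have "has_bochner_integral lborel (\<lambda>x. of_real (sqrt (2 * pi)) * (std_normal_density x *\<^sub>R iexp (t * x)))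
      (of_real (sqrt (2 * pi)) * complex_of_real (exp (- (t^2) / 2)))"
    by (rule has_bochner_integral_mult_right[rotated])
  moreover have "of_real (sqrt (2 * pi)) * (std_normal_density x *\<^sub>R iexp (t * x))
      = exp (of_real (- x\<^sup>2 / 2) + \<i> * of_real (t * x))" for x
  proof -
    have "sqrt (2 * pi) * std_normal_density x = exp (- x\<^sup>2 / 2)"
      by (simp add: std_normal_density_def)
    then have "of_real (sqrt (2 * pi)) * of_real (std_normal_density x) = exp (complex_of_real (- x\<^sup>2 / 2))"
      by (metis exp_of_real of_real_mult)
    then show ?thesis
      unfolding exp_add scaleR_conv_of_real mult.assoc[symmetric] by simp
  qed
  moreover have "complex_of_real (exp (- (t^2) / 2)) = exp (- (of_real t)\<^sup>2 / 2)"
    by (simp flip: exp_of_real)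
  ultimately show ?thesis by simp
qed

lemma has_bochner_integral_real_gaussian:
  fixes h :: real and s :: complex
  assumes "h > 0"
  shows "has_bochner_integral lborel (\<lambda>x::real. exp (- of_real h * of_real x ^ 2 + s * of_real x))
           (of_real (sqrt (pi / h)) * exp (s\<^sup>2 / (4 * of_real h)))"
proof -
  \<comment> \<open>Real substitution x = m + c y: \<open>c\<close> brings the quadratic coefficient
    to 1/2, and \<open>m\<close> absorbs the real part of \<open>s\<close>. The imaginary part
    cannot be absorbed by a real shift; it becomes the frequency \<open>Im s * c\<close> of the
    characteristic function.\<close>
  define c where "c = 1 / sqrt (2 * h)"
  define m where "m = Re s / (2 * h)"
  have c: "c > 0" "c ^ 2 = 1 / (2 * h)"
    using assms by (auto simp: c_def power_divide)
  define K where "K = exp (of_real (h * m\<^sup>2) + \<i> * of_real (Im s * m))"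
  have s: "s = of_real (2 * h * m) + \<i> * of_real (Im s)"
    using assms by (simp add: m_def complex_eq_iff)
  have eq: "exp (- of_real h * of_real (m + c * x) ^ 2 + s * of_real (m + c * x))
      = K * exp (of_real (- x\<^sup>2 / 2) + \<i> * of_real ((Im s * c) * x))" for x :: real
  proof -
    have "h * (m + c * x) ^ 2 = h * m ^ 2 + 2 * h * m * c * x + (h * c ^ 2) * x ^ 2"
      by (simp add: power2_eq_square algebra_simps)
    also have "h * c ^ 2 = 1 / 2" using assms c by simp
    finally have 1: "h * (m + c * x) ^ 2 = h * m ^ 2 + 2 * h * m * c * x + 1 / 2 * x ^ 2" .
    have "- of_real h * of_real (m + c * x) ^ 2 + s * of_real (m + c * x)
      = - complex_of_real (h * (m + c * x) ^ 2) + (of_real (2 * h * m) + \<i> * of_real (Im s)) * of_real (m + c * x)"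
      by (subst s) simp
    also have "\<dots> = (of_real (h * m\<^sup>2) + \<i> * of_real (Im s * m)) + (of_real (- x\<^sup>2 / 2) + \<i> * of_real ((Im s * c) * x))"
      unfolding 1 by (simp add: algebra_simps power2_eq_square)
    finally show ?thesis by (simp only: K_def exp_add)
  qed
  have "has_bochner_integral lborel (\<lambda>x. K * exp (of_real (- x\<^sup>2 / 2) + \<i> * of_real ((Im s * c) * x)))
     (K * (of_real (sqrt (2 * pi)) * exp (- (of_real (Im s * c))\<^sup>2 / 2)))"
    by (intro has_bochner_integral_mult_right has_bochner_integral_std_gaussian_iexp)
  also have "K * (of_real (sqrt (2 * pi)) * exp (- (of_real (Im s * c))\<^sup>2 / 2))
     = (of_real (sqrt (pi / h)) * exp (s\<^sup>2 / (4 * of_real h))) /\<^sub>R \<bar>c\<bar>"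
  proof -
    have "of_real (h * m\<^sup>2) + \<i> * of_real (Im s * m) + (- (of_real (Im s * c))\<^sup>2 / 2) = s\<^sup>2 / (4 * of_real h)"
    proof -
      have "(complex_of_real (Im s * c))\<^sup>2 = of_real ((Im s)\<^sup>2 / (2 * h))"
        by (simp only: of_real_power[symmetric] power_mult_distrib c) simp
      then show ?thesis
        by (subst (2) s, use assms in \<open>simp add: field_simps power2_eq_square\<close>)
    qed
    then have 1: "K * exp (- (of_real (Im s * c))\<^sup>2 / 2) = exp (s\<^sup>2 / (4 * of_real h))"
      unfolding K_def exp_add[symmetric] by simp
    have "sqrt (2 * pi) = sqrt (pi / h) / \<bar>c\<bar>"
      using assms by (simp add: c_def real_sqrt_mult real_sqrt_divide)
    then have 2: "complex_of_real (sqrt (2 * pi)) = of_real (sqrt (pi / h)) / of_real \<bar>c\<bar>"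
      by (simp only: of_real_divide)
    have "K * (of_real (sqrt (2 * pi)) * exp (- (of_real (Im s * c))\<^sup>2 / 2))
        = of_real (sqrt (2 * pi)) * (K * exp (- (of_real (Im s * c))\<^sup>2 / 2))"
      by (simp only: mult_ac)
    also have "\<dots> = of_real (sqrt (pi / h)) / of_real \<bar>c\<bar> * exp (s\<^sup>2 / (4 * of_real h))"
      by (simp only: 1 2)
    also have "\<dots> = (of_real (sqrt (pi / h)) * exp (s\<^sup>2 / (4 * of_real h))) /\<^sub>R \<bar>c\<bar>"
      by (simp only: scaleR_conv_of_real of_real_inverse divide_inverse mult_ac)
    finally show ?thesis .
  qed
  finally have "has_bochner_integral lborel (\<lambda>x. exp (- of_real h * of_real (m + c * x) ^ 2 + s * of_real (m + c * x)))
      ((of_real (sqrt (pi / h)) * exp (s\<^sup>2 / (4 * of_real h))) /\<^sub>R \<bar>c\<bar>)"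
    unfolding eq .
  moreover have "c \<noteq> 0" using c by simp
  ultimately show ?thesis
    by (rule iffD2[OF lborel_has_bochner_integral_real_affine_iff, rotated])
qed

lemma integrable_complex_gaussian_line:
  fixes h s :: complex
  assumes "Re h > 0"
  shows "integrable lborel (\<lambda>x::real. exp (- h * of_real x ^ 2 + s * of_real x))"
proof (rule Bochner_Integration.integrable_bound)
  show "integrable lborel (\<lambda>x::real. exp (- of_real (Re h) * of_real x ^ 2 + of_real (Re s) * of_real x :: complex))"
    using has_bochner_integral_real_gaussian[OF assms, of "of_real (Re s)"] by (simp add: has_bochner_integral_iff)
  show "AE x in lborel. norm (exp (- h * of_real x ^ 2 + s * of_real x))
      \<le> norm (exp (- of_real (Re h) * of_real x ^ 2 + of_real (Re s) * of_real x :: complex))"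
    by (auto simp: norm_exp_eq_Re simp flip: of_real_power)
qed (auto intro!: borel_measurable_continuous_onI continuous_intros)

text \<open>Identity theorem in \<open>h\<close>: both sides are holomorphic on the right half-plane
  and agree on the positive reals, which accumulate at 1.\<close>

lemma integral_complex_gaussian_line:
  fixes h s :: complex
  assumes "Re h > 0"
  shows "(\<integral>x. exp (- h * of_real x ^ 2 + s * of_real x) \<partial>(lborel :: real measure))
           = csqrt (of_real pi / h) * exp (s\<^sup>2 / (4 * h))"
proof -
  let ?U = "{h. Re h > 0}"
  define F where "F = (\<lambda>h. \<integral>x. exp (- h * of_real x ^ 2 + s * of_real x) \<partial>(lborel :: real measure))"
  define G where "G = (\<lambda>h. csqrt (of_real pi / h) * exp (s\<^sup>2 / (4 * h)))"
  have U: "open ?U" "connected ?U"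
    by (auto intro!: convex_connected convex_halfspace_Re_gt open_halfspace_Re_gt)
  \<comment> \<open>Power series at \<open>h0\<close>: expand exp (- (w - h0) x^2) and integrate
    termwise. The partial sums are dominated by exp (|w - h0| x^2), and |w - h0| < Re h0 leaves an
    integrable Gaussian.\<close>
  have "F holomorphic_on ball h0 (Re h0)" if h0: "Re h0 > 0" for h0
  proof (rule power_series_holomorphic)
    fix w assume w: "w \<in> ball h0 (Re h0)"
    define e where "e = w - h0"
    have e: "cmod e < Re h0" using w by (simp add: e_def dist_norm norm_minus_commute)
    define t where "t = (\<lambda>i (x::real). (- (of_real x ^ 2)) ^ i / fact i * exp (- h0 * of_real x ^ 2 + s * of_real x))"
    have bnd: "norm ((\<Sum>i<n. (- e * of_real x ^ 2) ^ i / fact i) * exp (- h0 * of_real x ^ 2 + s * of_real x))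
       \<le> norm (exp (- (of_real (Re h0 - cmod e)) * of_real x ^ 2 + of_real (Re s) * of_real x :: complex))"
      for n and x :: real
    proof -
      have "norm (\<Sum>i<n. (- e * of_real x ^ 2) ^ i / fact i) \<le> (\<Sum>i<n. (cmod e * x ^ 2) ^ i / fact i)"
        by (rule sum_norm_le) (simp add: norm_mult norm_power norm_divide)
      also have "\<dots> \<le> exp (cmod e * x ^ 2)"
      proof -
        have "(\<lambda>i. (cmod e * x ^ 2) ^ i / fact i) sums exp (cmod e * x ^ 2)"
          using exp_converges[of "cmod e * x ^ 2"] by (simp add: divide_inverse mult.commute)
        then show ?thesis unfolding sums_iff by (metis (no_types, lifting) sum_le_suminf finite_lessThan zero_le_divide_iff zero_le_power fact_ge_zero mult_nonneg_nonneg norm_ge_zero zero_le_power2)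
      qed
      finally have "norm ((\<Sum>i<n. (- e * of_real x ^ 2) ^ i / fact i) * exp (- h0 * of_real x ^ 2 + s * of_real x))
        \<le> exp (cmod e * x ^ 2) * norm (exp (- h0 * of_real x ^ 2 + s * of_real x))"
        by (simp add: norm_mult mult_right_mono)
      also have "\<dots> = norm (exp (- (of_real (Re h0 - cmod e)) * of_real x ^ 2 + of_real (Re s) * of_real x :: complex))"
        by (simp add: norm_exp_eq_Re exp_add[symmetric] algebra_simps flip: of_real_power of_real_diff)
      finally show ?thesis .
    qed
    have gint: "integrable lborel (\<lambda>x::real. exp (- (of_real (Re h0 - cmod e)) * of_real x ^ 2 + of_real (Re s) * of_real x :: complex))"
      using e by (intro integrable_complex_gaussian_line) simp
    have "(\<lambda>n. \<integral>x. (\<Sum>i<n. (- e * of_real x ^ 2) ^ i / fact i) * exp (- h0 * of_real x ^ 2 + s * of_real x) \<partial>lborel)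
        \<longlonglongrightarrow> (\<integral>x. exp (- w * of_real x ^ 2 + s * of_real x) \<partial>lborel)"
    proof (rule integral_dominated_convergence[OF _ _ integrable_norm[OF gint]])
      show "AE x in lborel. (\<lambda>n. (\<Sum>i<n. (- e * of_real x ^ 2) ^ i / fact i) * exp (- h0 * of_real x ^ 2 + s * of_real x))
          \<longlonglongrightarrow> exp (- w * of_real x ^ 2 + s * of_real x)"
      proof (intro AE_I2)
        fix x :: real
        have "(\<lambda>i. (- e * of_real x ^ 2) ^ i / fact i) sums exp (- e * of_real x ^ 2)"
          using exp_converges[of "- e * of_real x ^ 2"] by (simp add: scaleR_conv_of_real divide_inverse mult.commute)
        then have "(\<lambda>n. (\<Sum>i<n. (- e * of_real x ^ 2) ^ i / fact i) * exp (- h0 * of_real x ^ 2 + s * of_real x))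
          \<longlonglongrightarrow> exp (- e * of_real x ^ 2) * exp (- h0 * of_real x ^ 2 + s * of_real x)"
          unfolding sums_def by (intro tendsto_intros)
        also have "exp (- e * of_real x ^ 2) * exp (- h0 * of_real x ^ 2 + s * of_real x) = exp (- w * of_real x ^ 2 + s * of_real x)"
          by (simp add: e_def exp_add[symmetric] algebra_simps)
        finally show "(\<lambda>n. (\<Sum>i<n. (- e * of_real x ^ 2) ^ i / fact i) * exp (- h0 * of_real x ^ 2 + s * of_real x))
          \<longlonglongrightarrow> exp (- w * of_real x ^ 2 + s * of_real x)" .
      qed
    qed (use bnd in \<open>auto intro!: borel_measurable_continuous_onI continuous_intros\<close>)
    moreover have "(\<integral>x. (\<Sum>i<n. (- e * of_real x ^ 2) ^ i / fact i) * exp (- h0 * of_real x ^ 2 + s * of_real x) \<partial>lborel)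
      = (\<Sum>i<n. integral\<^sup>L lborel (t i) * (w - h0) ^ i)" for n
    proof -
      have fac: "(- e * of_real x ^ 2) ^ i = e ^ i * (- (of_real x ^ 2)) ^ i" for x :: real and i
        by (simp add: power_mult_distrib[symmetric])
      \<comment> \<open>A single term is the difference of two consecutive partial sums, so the
        bound on partial sums already gives its integrability.\<close>
      have "integrable lborel (\<lambda>x::real. (- e * of_real x ^ 2) ^ i / fact i * exp (- h0 * of_real x ^ 2 + s * of_real x))" for i
      proof (rule Bochner_Integration.integrable_diff[of _ "\<lambda>x. (\<Sum>i<Suc i. (- e * of_real x ^ 2) ^ i / fact i) * exp (- h0 * of_real x ^ 2 + s * of_real x)"
           "\<lambda>x. (\<Sum>i<i. (- e * of_real x ^ 2) ^ i / fact i) * exp (- h0 * of_real x ^ 2 + s * of_real x)", THEN integrable_cong_AE_imp])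
        show "integrable lborel (\<lambda>x. (\<Sum>i<n. (- e * of_real x ^ 2) ^ i / fact i) * exp (- h0 * of_real x ^ 2 + s * of_real x))" for n
          by (rule Bochner_Integration.integrable_bound[OF gint])
             (use bnd in \<open>auto intro!: borel_measurable_continuous_onI continuous_intros\<close>)
        then show "integrable lborel (\<lambda>x. (\<Sum>i<n. (- e * of_real x ^ 2) ^ i / fact i) * exp (- h0 * of_real x ^ 2 + s * of_real x))" for n .
      qed (auto simp: algebra_simps intro!: borel_measurable_continuous_onI continuous_intros)
      then have "(\<integral>x. (\<Sum>i<n. (- e * of_real x ^ 2) ^ i / fact i) * exp (- h0 * of_real x ^ 2 + s * of_real x) \<partial>lborel)
       = (\<Sum>i<n. \<integral>x. (- e * of_real x ^ 2) ^ i / fact i * exp (- h0 * of_real x ^ 2 + s * of_real x) \<partial>lborel)"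
        by (simp add: sum_distrib_right)
      also have "\<dots> = (\<Sum>i<n. integral\<^sup>L lborel (t i) * (w - h0) ^ i)"
        unfolding fac t_def e_def[symmetric] by (intro sum.cong refl) (simp add: mult.assoc mult.commute flip: integral_mult_right_zero)
      finally show ?thesis .
    qed
    ultimately show "(\<lambda>n. integral\<^sup>L lborel (t n) * (w - h0) ^ n) sums F w"
      by (simp add: sums_def F_def)
  qed
  then have "F field_differentiable at h0" if "Re h0 > 0" for h0
    using that by (intro holomorphic_on_imp_differentiable_at[of F "ball h0 (Re h0)"]) auto
  then have F: "F holomorphic_on ?U"
    by (simp add: U holomorphic_on_open) (simp add: field_differentiable_def)
  \<comment> \<open>\<open>csqrt\<close> is holomorphic off the nonpositive reals, and pi / h avoids
    them on the half-plane.\<close>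
  have nonpos: "of_real pi / h \<notin> \<real>\<^sub>\<le>\<^sub>0" if "Re h > 0" for h
  proof
    assume "of_real pi / h \<in> \<real>\<^sub>\<le>\<^sub>0"
    then obtain r where r: "of_real pi / h = complex_of_real r" "r \<le> 0" by (auto elim: nonpos_Reals_cases)
    moreover have "h \<noteq> 0" using that by auto
    ultimately have "complex_of_real pi = of_real r * h" by (simp add: field_simps)
    then have "Re (complex_of_real pi) = Re (of_real r * h)" by (rule arg_cong)
    then have "pi = r * Re h" by simp
    with r(2) that show False
      by (smt (verit) mult_nonpos_nonneg pi_gt_zero)
  qed
  have G: "G holomorphic_on ?U"
    unfolding G_def by (intro holomorphic_intros) (use nonpos in auto)
  have "F h - G h = 0"
  proof (rule analytic_continuation[of "\<lambda>h. F h - G h" ?U "complex_of_real ` {0<..}" 1])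
    show "1 islimpt complex_of_real ` {0<..}"
    proof (rule islimptI)
      fix T assume "1 \<in> T" "open (T::complex set)"
      then obtain e where e: "e > 0" "ball 1 e \<subseteq> T" using openE by blast
      then have "complex_of_real (1 + e / 2) \<in> T"
        by (intro subsetD[OF e(2)]) (simp add: dist_norm)
      then show "\<exists>y\<in>complex_of_real ` {0<..}. y \<in> T \<and> y \<noteq> 1"
        using e by (intro bexI[of _ "complex_of_real (1 + e / 2)"]) (auto intro!: imageI simp del: of_real_add)
    qed
    show "F z - G z = 0" if "z \<in> complex_of_real ` {0<..}" for z
    proof -
      from that obtain r where r: "r > 0" "z = of_real r" by auto
      have "pi / r \<ge> 0" using r(1) by simp
      then have "csqrt (complex_of_real pi / of_real r) = of_real (sqrt (pi / r))"
        using csqrt_of_real_nonneg[of "pi / r"] by simp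
      then show ?thesis
        using has_bochner_integral_real_gaussian[OF r(1), of s] r
        by (simp add: F_def G_def has_bochner_integral_iff)
    qed
  qed (use U assms F G in \<open>auto intro!: holomorphic_intros\<close>)
  then show ?thesis by (simp add: F_def G_def)
qed

section \<open>Lebesgue measure on the plane and on complex vectors as a product\<close>

lemma lborel_complex_eq_distr:
  "(lborel :: complex measure) = distr (lborel \<Otimes>\<^sub>M lborel) borel (\<lambda>(x, y). Complex x y)"
proof (rule lborel_eqI)
  fix l u :: complex
  assume le: "\<And>b. b \<in> Basis \<Longrightarrow> l \<bullet> b \<le> u \<bullet> b"
  have le': "Re l \<le> Re u" "Im l \<le> Im u" using le[of 1] le[of \<i>] by (auto simp: Basis_complex_def)
  have meas: "(\<lambda>(x, y). Complex x y) \<in> (lborel \<Otimes>\<^sub>M lborel) \<rightarrow>\<^sub>M (borel :: complex measure)"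
    by (auto simp: Complex_eq split_beta intro!: borel_measurable_add borel_measurable_times)
  have "(\<lambda>(x, y). Complex x y) -` box l u \<inter> space (lborel \<Otimes>\<^sub>M lborel) = {Re l<..<Re u} \<times> {Im l<..<Im u}"
    by (auto simp: space_pair_measure box_def Basis_complex_def)
  then have "emeasure (distr (lborel \<Otimes>\<^sub>M lborel) borel (\<lambda>(x, y). Complex x y)) (box l u)
      = emeasure (lborel \<Otimes>\<^sub>M lborel) ({Re l<..<Re u} \<times> {Im l<..<Im u})"
    by (subst emeasure_distr[OF meas]) auto
  also have "\<dots> = ennreal (Re u - Re l) * ennreal (Im u - Im l)"
    using le' by (subst lborel.emeasure_pair_measure_Times) auto
  also have "\<dots> = ennreal (\<Prod>b\<in>Basis. (u - l) \<bullet> b)"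
    using le' by (simp add: Basis_complex_def ennreal_mult')
  finally show "emeasure (distr (lborel \<Otimes>\<^sub>M lborel) borel (\<lambda>(x, y). Complex x y)) (box l u)
      = ennreal (\<Prod>b\<in>Basis. (u - l) \<bullet> b)" .
qed simp

text \<open>With w = x + i y the exponent separates into linear coefficients a + b and i (a - b).
  Both line integrals carry the same factor csqrt (pi / h), so only its square pi / h survives; this
  is where the branch disappears. Since \<open>a\<close> and \<open>b\<close> are unrelated, the
  value a b / h is the polarised form.\<close>

lemma has_bochner_integral_complex_plane_gaussian:
  fixes h a b :: complex
  assumes h: "Re h > 0"
  shows "has_bochner_integral lborel (\<lambda>w. exp (- h * (cnj w * w) + a * w + b * cnj w))
           (of_real pi / h * exp (a * b / h))"
proof -
  define f where "f = (\<lambda>x::real. exp (- h * of_real x ^ 2 + (a + b) * of_real x))"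
  define g where "g = (\<lambda>y::real. exp (- h * of_real y ^ 2 + \<i> * (a - b) * of_real y))"
  have int: "integrable lborel f" "integrable lborel g"
    unfolding f_def g_def by (rule integrable_complex_gaussian_line[OF h])+
  have meas: "(\<lambda>(x, y). Complex x y) \<in> (lborel \<Otimes>\<^sub>M lborel) \<rightarrow>\<^sub>M (borel :: complex measure)"
    by (auto simp: Complex_eq split_beta intro!: borel_measurable_add borel_measurable_times)
  have F: "exp (- h * (cnj (Complex x y) * Complex x y) + a * Complex x y + b * cnj (Complex x y)) = f x * g y" for x y
    unfolding f_def g_def exp_add[symmetric]
    by (rule arg_cong[of _ _ exp]) (simp add: complex_eq_iff power2_eq_square algebra_simps)
  have fg: "integrable (lborel \<Otimes>\<^sub>M lborel) (\<lambda>(x, y). f x * g y)"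
  proof (rule lborel_pair.Fubini_integrable)
    show "(\<lambda>(x, y). f x * g y) \<in> borel_measurable (lborel \<Otimes>\<^sub>M lborel)"
      using int[THEN borel_measurable_integrable] by simp
    show "integrable lborel (\<lambda>x. \<integral>y. norm (case (x, y) of (x, y) \<Rightarrow> f x * g y) \<partial>lborel)"
      using int by (simp add: norm_mult)
    show "AE x in lborel. integrable lborel (\<lambda>y. case (x, y) of (x, y) \<Rightarrow> f x * g y)"
      using int by simp
  qed
  have "(\<integral>p. (case p of (x, y) \<Rightarrow> f x * g y) \<partial>(lborel \<Otimes>\<^sub>M lborel)) = (\<integral>x. \<integral>y. f x * g y \<partial>lborel \<partial>lborel)"
    using lborel_pair.integral_fst'[OF fg] by simp
  also have "\<dots> = integral\<^sup>L lborel f * integral\<^sup>L lborel g" by simp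
  also have "\<dots> = (csqrt (of_real pi / h))\<^sup>2 * exp ((a + b)\<^sup>2 / (4 * h) + (\<i> * (a - b))\<^sup>2 / (4 * h))"
    unfolding f_def g_def integral_complex_gaussian_line[OF h]
    by (simp only: exp_add power2_eq_square mult_ac)
  also have "(a + b)\<^sup>2 / (4 * h) + (\<i> * (a - b))\<^sup>2 / (4 * h) = a * b / h"
  proof -
    have "(a + b)\<^sup>2 + (\<i> * (a - b))\<^sup>2 = 4 * (a * b)"
      by (simp add: power2_eq_square algebra_simps)
    then show ?thesis by (simp add: add_divide_distrib[symmetric])
  qed
  finally have val: "(\<integral>p. (case p of (x, y) \<Rightarrow> f x * g y) \<partial>(lborel \<Otimes>\<^sub>M lborel)) = of_real pi / h * exp (a * b / h)"
    by simp
  have "has_bochner_integral (lborel \<Otimes>\<^sub>M lborel) (\<lambda>p. exp (- h * (cnj (case p of (x, y) \<Rightarrow> Complex x y) * (case p of (x, y) \<Rightarrow> Complex x y))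
       + a * (case p of (x, y) \<Rightarrow> Complex x y) + b * cnj (case p of (x, y) \<Rightarrow> Complex x y)))
      (of_real pi / h * exp (a * b / h))"
    using fg[unfolded case_prod_beta'] val F by (simp add: has_bochner_integral_iff split_beta)
  then show ?thesis
    by (subst lborel_complex_eq_distr, intro has_bochner_integral_distr[OF _ meas])
      (auto intro!: borel_measurable_continuous_onI continuous_intros)
qed

lemma integrable_complex_plane_gaussian_norm:
  assumes "c > (0::real)"
  shows "integrable lborel (\<lambda>w::complex. exp (- c * (norm w)\<^sup>2))"
proof -
  have "integrable lborel (\<lambda>w. norm (exp (- of_real c * (cnj w * w) + 0 * w + 0 * cnj w)))"
    using has_bochner_integral_complex_plane_gaussian[of "of_real c" 0 0] assms
    by (intro integrable_norm) (auto simp: has_bochner_integral_iff)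
  then show ?thesis
    by (simp add: norm_exp_eq_Re complex_mult_cnj cmod_power2 mult.commute[of "cnj _"])
qed

lemma measurable_vec_lambda_PiM:
  "(\<lambda>f. \<chi> i. f i) \<in> (\<Pi>\<^sub>M i\<in>UNIV. lborel) \<rightarrow>\<^sub>M (borel :: (complex ^ 'n) measure)"
proof (rule borel_measurable_euclidean_space[THEN iffD2], rule ballI)
  fix b :: "complex ^ 'n" assume "b \<in> Basis"
  then obtain i c where b: "b = axis i c" "c \<in> Basis" by (auto simp: Basis_vec_def)
  have "(\<lambda>f. f i \<bullet> c) \<in> borel_measurable (\<Pi>\<^sub>M i\<in>(UNIV::'n set). (lborel :: complex measure))"
    by measurable
  then show "(\<lambda>f. (\<chi> i. f i) \<bullet> b) \<in> borel_measurable (\<Pi>\<^sub>M i\<in>(UNIV::'n set). (lborel :: complex measure))"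
    by (simp add: b inner_axis)
qed

text \<open>Compared on boxes: the basis of the vector space is the disjoint union over the
  coordinates of copies of \<open>{1, \<i>}\<close>, so the product of side lengths regroups
  coordinatewise.\<close>

lemma lborel_complex_vec_eq_distr:
  "(lborel :: (complex ^ 'n) measure) = distr (\<Pi>\<^sub>M i\<in>UNIV. lborel) borel (\<lambda>f. \<chi> i. f i)"
proof (rule lborel_eqI)
  interpret product_sigma_finite "\<lambda>_::'n. lborel :: complex measure" ..
  fix l u :: "complex ^ 'n"
  assume le: "\<And>b. b \<in> Basis \<Longrightarrow> l \<bullet> b \<le> u \<bullet> b"
  have le': "l $ i \<bullet> b \<le> u $ i \<bullet> b" if "b \<in> Basis" for i b
    using le[of "axis i b"] that by (auto simp: Basis_vec_def inner_axis)
  have box: "box l u = {x. \<forall>i. x $ i \<in> box (l $ i) (u $ i)}"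
    by (auto simp: box_def Basis_vec_def inner_axis)
  have "(\<lambda>f. \<chi> i. f i) -` box l u \<inter> space (\<Pi>\<^sub>M i\<in>UNIV. lborel) = (\<Pi>\<^sub>E i\<in>UNIV. box (l $ i) (u $ i))"
    by (auto simp: box space_PiM PiE_def Pi_def)
  then have "emeasure (distr (\<Pi>\<^sub>M i\<in>UNIV. lborel) borel (\<lambda>f. \<chi> i. f i)) (box l u)
      = emeasure (\<Pi>\<^sub>M i\<in>UNIV. lborel) (\<Pi>\<^sub>E i\<in>UNIV. box (l $ i) (u $ i))"
    by (subst emeasure_distr[OF measurable_vec_lambda_PiM]) auto
  also have "\<dots> = (\<Prod>i\<in>UNIV. emeasure lborel (box (l $ i) (u $ i)))"
    by (rule emeasure_PiM) auto
  also have "\<dots> = (\<Prod>i\<in>UNIV. ennreal (\<Prod>b\<in>Basis. (u $ i - l $ i) \<bullet> b))"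
    using le' by (intro prod.cong refl emeasure_lborel_box)
  also have "\<dots> = ennreal (\<Prod>i\<in>UNIV. \<Prod>b\<in>Basis. (u $ i - l $ i) \<bullet> b)"
    by (rule prod_ennreal) (auto intro!: prod_nonneg simp: inner_diff_left le')
  also have "(\<Prod>i\<in>UNIV. \<Prod>b\<in>Basis. (u $ i - l $ i) \<bullet> b) = (\<Prod>b\<in>Basis. (u - l) \<bullet> b)"
  proof -
    have "(\<Prod>b\<in>Basis. (u - l) \<bullet> b) = (\<Prod>b\<in>(\<Union>i\<in>UNIV. axis i ` Basis). (u - l) \<bullet> b)"
      by (rule prod.cong) (auto simp: Basis_vec_def)
    also have "\<dots> = (\<Prod>i\<in>UNIV. \<Prod>b\<in>axis i ` Basis. (u - l) \<bullet> b)"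
      by (rule prod.UNION_disjoint) (auto simp: axis_eq_axis nonzero_Basis)
    also have "\<dots> = (\<Prod>i\<in>UNIV. \<Prod>b\<in>Basis. (u - l) \<bullet> axis i b)"
      by (intro prod.cong refl prod.reindex_cong[OF _ refl refl]) (auto simp: inj_on_def axis_eq_axis)
    finally show ?thesis by (simp add: inner_axis)
  qed
  finally show "emeasure (distr (\<Pi>\<^sub>M i\<in>UNIV. lborel) borel (\<lambda>f. \<chi> i. f i)) (box l u)
      = ennreal (\<Prod>b\<in>Basis. (u - l) \<bullet> b)" .
qed simp

section \<open>Gaussian integrals over products of planes\<close>

text \<open>The dimension is a type and cannot shrink during an induction on the index set
  \<open>I\<close>. Completing the submatrix on \<open>I\<close> by the identity keeps the type and
  makes the determinant the principal minor on \<open>I\<close>.\<close>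

definition pad_matrix :: "'n set \<Rightarrow> ('n \<Rightarrow> 'n \<Rightarrow> complex) \<Rightarrow> complex ^ 'n ^ 'n"
  where "pad_matrix I H = (\<chi> p q. if p \<in> I \<and> q \<in> I then H p q else if p = q then 1 else 0)"

text \<open>A row operation: since the entry of \<open>x\<close> at \<open>i\<close> vanishes,
  \<open>x\<close> lies in the span of the other rows of the identity.\<close>

lemma det_add_row_multiples:
  fixes x :: "complex ^ 'n"
  assumes "x $ i = 0"
  shows "det (\<chi> p q. (if p = q then 1 else 0) + (if p = i then x $ q else 0)) = 1"
proof -
  have "x = (\<Sum>j\<in>UNIV. x $ j *s axis j 1)"
    by (simp add: vec_eq_iff axis_def if_distrib cong: if_cong)
  also have "\<dots> \<in> vec.span {row j (mat 1) | j. j \<noteq> i}"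
  proof (rule vec.span_sum)
    fix j
    show "x $ j *s axis j 1 \<in> vec.span {row j (mat 1) | j. j \<noteq> i}"
    proof (cases "j = i")
      case True
      then show ?thesis using assms by (simp add: vec.span_zero)
    next
      case False
      then have "(axis j 1 :: complex ^ 'n) \<in> {row j (mat 1) | j. j \<noteq> i}"
        by (auto simp: row_def mat_def axis_def vec_eq_iff intro!: exI[of _ j])
      then show ?thesis by (intro vec.span_scale vec.span_base)
    qed
  qed
  finally have "det (\<chi> k. if k = i then row i (mat 1) + x else row k (mat 1)) = det (mat 1 :: complex ^ 'n ^ 'n)"
    by (rule det_row_span)
  moreover have "(\<chi> k. if k = i then row i (mat 1) + x else row k (mat 1))
     = (\<chi> p q. (if p = q then 1 else 0) + (if p = i then x $ q else 0))"
    by (auto simp: vec_eq_iff row_def mat_def)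
  ultimately show ?thesis by simp
qed

text \<open>Schur's determinant formula with pivot \<open>H i i\<close>: row and column elimination,
  both of determinant 1, decouple the index \<open>i\<close> from \<open>I\<close>.\<close>

lemma det_pad_matrix_insert:
  fixes H :: "'n::finite \<Rightarrow> 'n \<Rightarrow> complex"
  assumes i: "i \<notin> I" and h: "H i i \<noteq> 0"
  shows "det (pad_matrix (insert i I) H) = H i i * det (pad_matrix I (\<lambda>p q. H p q - H p i * H i q / H i i))"
proof -
  let ?h = "H i i"
  define N where "N = pad_matrix I (\<lambda>p q. H p q - H p i * H i q / ?h)"
  define L where "L = (\<chi> p q. (if p = q then 1 else 0) + (if p = i then (\<chi> q. if q \<in> I then H q i / ?h else 0) $ q else 0))"
  define R where "R = (\<chi> p q. (if p = q then 1 else 0) + (if p = i then (\<chi> q. if q \<in> I then H i q / ?h else 0) $ q else 0))"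
  \<comment> \<open>The decoupled matrix. Row \<open>i\<close> of \<open>N\<close> is a unit row
    because \<open>i\<close> is outside \<open>I\<close>; scaling it puts the pivot there and leaves
    the Schur complement on \<open>I\<close>.\<close>
  define N1 where "N1 = (\<chi> p. if p = i then ?h *s N $ i else N $ p)"
  have "det L = 1" "det R = 1"
    unfolding L_def R_def by (rule det_add_row_multiples, use i in simp)+
  moreover have "det N1 = ?h * det N"
  proof -
    have "(\<chi> p. if p = i then N $ i else N $ p) = N" by (auto simp: vec_eq_iff)
    then show ?thesis
      unfolding N1_def det_row_mul[of i ?h "\<lambda>_. N $ i" "\<lambda>p. N $ p"] by simp
  qed
  moreover have "pad_matrix (insert i I) H = transpose L ** N1 ** R"
  proof -
    have N1: "N1 $ p $ q = (if p = i then (if q = i then ?h else 0) else N $ p $ q)" for p q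
      using i by (auto simp: N1_def N_def pad_matrix_def)
    have LN: "(transpose L ** N1) $ p $ q = N1 $ p $ q + (if p \<in> I \<and> q = i then H p i else 0)" for p q
      using h by (simp add: matrix_matrix_mult_def transpose_def L_def distrib_right sum.distrib if_distrib[of "\<lambda>x. x * _"] N1 cong: if_cong)
    have "(X ** R) $ p $ q = X $ p $ q + (if q \<in> I then X $ p $ i * H i q / ?h else 0)" for X :: "complex ^ 'n ^ 'n" and p q
      by (simp add: matrix_matrix_mult_def R_def distrib_left sum.distrib if_distrib[of "\<lambda>x. _ * x"] cong: if_cong)
    then show ?thesis
      using i h unfolding vec_eq_iff by (auto simp: LN N1 N_def pad_matrix_def)
  qed
  ultimately show ?thesis by (simp add: det_mul N_def)
qed

text \<open>Coercivity dominates the integrand by a product of one-coordinate Gaussians, which is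
  integrable factor by factor.\<close>

lemma integrable_gaussian_PiM:
  fixes H :: "'n \<Rightarrow> 'n \<Rightarrow> complex" and \<kappa> :: real
  assumes "finite I" "\<kappa> > 0" "c > 0"
    and pos: "\<And>u. c * (\<Sum>p\<in>I. (norm (u p))\<^sup>2) \<le> Re (\<Sum>p\<in>I. \<Sum>q\<in>I. cnj (u p) * H p q * u q)"
  shows "integrable (Pi\<^sub>M I (\<lambda>_. lborel)) (\<lambda>u. exp (of_real \<kappa> *
           (- (\<Sum>p\<in>I. \<Sum>q\<in>I. cnj (u p) * H p q * u q) + (\<Sum>p\<in>I. a p * u p) + (\<Sum>p\<in>I. b p * cnj (u p)))))"
    (is "integrable ?M (\<lambda>u. exp (of_real \<kappa> * ?E u))")
proof (rule Bochner_Integration.integrable_bound)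
  interpret product_sigma_finite "\<lambda>_::'n. lborel :: complex measure" ..
  \<comment> \<open>\<open>m p\<close> bounds both linear terms in coordinate \<open>p\<close>. By
    the inequality of arithmetic and geometric means they cost half of the coercivity constant, so
    decay at rate c / 2 remains.\<close>
  define m where "m p = norm (a p) + norm (b p)" for p
  show "integrable ?M (\<lambda>u. \<Prod>p\<in>I. exp (\<kappa> * (m p)\<^sup>2 / (2 * c)) * exp (- (\<kappa> * c / 2) * (norm (u p))\<^sup>2))"
    using assms by (intro product_integrable_prod integrable_mult_right integrable_complex_plane_gaussian_norm) auto
  show "(\<lambda>u. exp (of_real \<kappa> * ?E u)) \<in> borel_measurable ?M"
  proof -
    have [measurable]: "cnj \<in> borel \<rightarrow>\<^sub>M borel" "(exp :: complex \<Rightarrow> complex) \<in> borel \<rightarrow>\<^sub>M borel"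
      by (auto intro!: borel_measurable_continuous_onI continuous_intros)
    show ?thesis by measurable
  qed
  show "AE u in ?M. norm (exp (of_real \<kappa> * ?E u))
      \<le> norm (\<Prod>p\<in>I. exp (\<kappa> * (m p)\<^sup>2 / (2 * c)) * exp (- (\<kappa> * c / 2) * (norm (u p))\<^sup>2))"
  proof (rule AE_I2)
    fix u :: "'n \<Rightarrow> complex"
    have am: "m p * norm (u p) \<le> (m p)\<^sup>2 / (2 * c) + c / 2 * (norm (u p))\<^sup>2" for p
    proof -
      have "0 \<le> (m p - c * norm (u p))\<^sup>2 / (2 * c)" using assms by simp
      also have "\<dots> = (m p)\<^sup>2 / (2 * c) + c / 2 * (norm (u p))\<^sup>2 - m p * norm (u p)"
        using assms by (simp add: power2_eq_square field_simps)
      finally show ?thesis by simp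
    qed
    have "Re (\<Sum>p\<in>I. a p * u p) + Re (\<Sum>p\<in>I. b p * cnj (u p)) = (\<Sum>p\<in>I. Re (a p * u p) + Re (b p * cnj (u p)))"
      by (simp add: sum.distrib)
    also have "\<dots> \<le> (\<Sum>p\<in>I. m p * norm (u p))"
    proof (rule sum_mono)
      fix p
      have "Re (a p * u p) \<le> norm (a p) * norm (u p)" "Re (b p * cnj (u p)) \<le> norm (b p) * norm (u p)"
        using complex_Re_le_cmod[of "a p * u p"] complex_Re_le_cmod[of "b p * cnj (u p)"] by (simp_all add: norm_mult)
      then show "Re (a p * u p) + Re (b p * cnj (u p)) \<le> m p * norm (u p)"
        by (simp add: m_def distrib_right)
    qed
    also have "\<dots> \<le> (\<Sum>p\<in>I. (m p)\<^sup>2 / (2 * c) + c / 2 * (norm (u p))\<^sup>2)"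
      by (intro sum_mono am)
    finally have "Re (?E u) \<le> - c * (\<Sum>p\<in>I. (norm (u p))\<^sup>2) + (\<Sum>p\<in>I. (m p)\<^sup>2 / (2 * c) + c / 2 * (norm (u p))\<^sup>2)"
      using pos[of u] by simp
    also have "\<dots> = (\<Sum>p\<in>I. (m p)\<^sup>2 / (2 * c) - c / 2 * (norm (u p))\<^sup>2)"
      unfolding sum_distrib_left sum.distrib[symmetric] by (intro sum.cong refl) (simp add: field_simps)
    finally have "\<kappa> * Re (?E u) \<le> \<kappa> * (\<Sum>p\<in>I. (m p)\<^sup>2 / (2 * c) - c / 2 * (norm (u p))\<^sup>2)"
      using assms by simp
    also have "\<dots> = (\<Sum>p\<in>I. \<kappa> * (m p)\<^sup>2 / (2 * c) + - (\<kappa> * c / 2) * (norm (u p))\<^sup>2)"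
      by (simp add: sum_distrib_left algebra_simps)
    finally have "exp (\<kappa> * Re (?E u)) \<le> exp (\<Sum>p\<in>I. \<kappa> * (m p)\<^sup>2 / (2 * c) + - (\<kappa> * c / 2) * (norm (u p))\<^sup>2)"
      by simp
    also have "\<dots> = (\<Prod>p\<in>I. exp (\<kappa> * (m p)\<^sup>2 / (2 * c)) * exp (- (\<kappa> * c / 2) * (norm (u p))\<^sup>2))"
      using assms by (simp only: exp_sum exp_add)
    finally show "norm (exp (of_real \<kappa> * ?E u))
      \<le> norm (\<Prod>p\<in>I. exp (\<kappa> * (m p)\<^sup>2 / (2 * c)) * exp (- (\<kappa> * c / 2) * (norm (u p))\<^sup>2))"
      by (simp add: norm_exp_eq_Re abs_prod abs_mult)
  qed
qed

text \<open>Gaussian elimination by Fubini: integrating out coordinate \<open>i\<close> leaves a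
  Gaussian with the Schur complement \<open>H'\<close> and corrected vectors \<open>a'\<close>,
  \<open>b'\<close>. Coercivity passes on with the same \<open>c\<close>, and the same
  \<open>x\<close> solves the reduced system. This is why the value is expressed through a solution
  \<open>x\<close>, which stays fixed in the induction while \<open>H\<close>, \<open>a\<close>,
  \<open>b\<close> vary.\<close>

lemma integral_gaussian_PiM:
  fixes H :: "'n::finite \<Rightarrow> 'n \<Rightarrow> complex" and \<kappa> :: real
  assumes \<kappa>: "\<kappa> > 0"
  shows "c > 0 \<Longrightarrow> (\<And>u. c * (\<Sum>p\<in>I. (norm (u p))\<^sup>2) \<le> Re (\<Sum>p\<in>I. \<Sum>q\<in>I. cnj (u p) * H p q * u q))
   \<Longrightarrow> (\<And>p. p \<in> I \<Longrightarrow> (\<Sum>q\<in>I. H p q * x q) = b p)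
   \<Longrightarrow> (\<integral>u. exp (of_real \<kappa> * (- (\<Sum>p\<in>I. \<Sum>q\<in>I. cnj (u p) * H p q * u q) + (\<Sum>p\<in>I. a p * u p) + (\<Sum>p\<in>I. b p * cnj (u p)))) \<partial>Pi\<^sub>M I (\<lambda>_. lborel))
     = of_real (pi / \<kappa>) ^ card I / det (pad_matrix I H) * exp (of_real \<kappa> * (\<Sum>p\<in>I. a p * x p))"
  using finite[of I]
proof (induction I arbitrary: H a b rule: finite_induct)
  case empty
  interpret product_sigma_finite "\<lambda>_::'n. lborel :: complex measure" ..
  have "(pad_matrix {} H) = mat 1" by (simp add: pad_matrix_def mat_def)
  then show ?case by (simp add: PiM_empty lebesgue_integral_count_space_finite)
next
  case (insert i I)
  interpret product_sigma_finite "\<lambda>_::'n. lborel :: complex measure" ..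
  let ?h = "H i i"
  define H' where "H' = (\<lambda>p q. H p q - H p i * H i q / ?h)"
  define a' where "a' = (\<lambda>q. a q - a i * H i q / ?h)"
  define b' where "b' = (\<lambda>p. b p - H p i * b i / ?h)"
  have split: "(\<Sum>p\<in>insert i I. f p) = f i + (\<Sum>p\<in>I. f p)" for f :: "'n \<Rightarrow> complex"
    using insert by simp
  have splitr: "(\<Sum>p\<in>insert i I. f p) = f i + (\<Sum>p\<in>I. f p)" for f :: "'n \<Rightarrow> real"
    using insert by simp
  have neq: "p \<noteq> i" if "p \<in> I" for p using that insert by auto
  have upd: "(\<Sum>p\<in>I. f p ((u(i := w)) p)) = (\<Sum>p\<in>I. f p (u p))" for f :: "'n \<Rightarrow> complex \<Rightarrow> complex" and u w
    using neq by (intro sum.cong) auto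
  have updr: "(\<Sum>p\<in>I. f p ((u(i := w)) p)) = (\<Sum>p\<in>I. f p (u p))" for f :: "'n \<Rightarrow> complex \<Rightarrow> real" and u w
    using neq by (intro sum.cong) auto
  \<comment> \<open>Coercivity tested on the unit vector at \<open>i\<close>: the pivot is nonzero
    and the plane integral over this coordinate converges.\<close>
  have h: "c \<le> Re ?h"
  proof -
    have "(\<Sum>p\<in>insert i I. \<Sum>q\<in>insert i I. cnj (of_bool (p = i)) * H p q * of_bool (q = i)) = ?h"
      using neq by (simp add: split)
    moreover have "(\<Sum>p\<in>insert i I. (norm (of_bool (p = i) :: complex))\<^sup>2) = 1"
      using neq by (simp add: splitr)
    ultimately show ?thesis using insert.prems(2)[of "\<lambda>p. of_bool (p = i)"] by simp
  qed
  then have h0: "?h \<noteq> 0" "Re ?h > 0" using insert.prems(1) by auto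
  define S where "S = (\<lambda>u. \<Sum>p\<in>I. \<Sum>q\<in>I. cnj (u p) * H p q * u q)"
  have quad: "(\<Sum>p\<in>insert i I. \<Sum>q\<in>insert i I. cnj ((u(i := w)) p) * H p q * (u(i := w)) q)
     = ?h * (cnj w * w) + (\<Sum>p\<in>I. cnj (u p) * H p i) * w + (\<Sum>q\<in>I. H i q * u q) * cnj w + S u" for u w
  proof -
    have "(\<Sum>p\<in>insert i I. \<Sum>q\<in>insert i I. cnj ((u(i := w)) p) * H p q * (u(i := w)) q)
      = cnj w * ?h * w + (\<Sum>q\<in>I. cnj w * H i q * u q) + (\<Sum>p\<in>I. cnj (u p) * H p i * w + (\<Sum>q\<in>I. cnj (u p) * H p q * u q))"
      unfolding split using neq by (simp cong: sum.cong)
    then show ?thesis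
      by (simp add: S_def sum.distrib sum_distrib_left sum_distrib_right mult_ac add_ac)
  qed
  define A where "A = (\<lambda>u. \<Sum>p\<in>I. cnj (u p) * H p i)"
  define B where "B = (\<lambda>u. \<Sum>q\<in>I. H i q * u q)"
  have H': "(\<Sum>p\<in>I. \<Sum>q\<in>I. cnj (u p) * H' p q * u q) = S u - A u * B u / ?h" for u
  proof -
    have "cnj (u p) * H' p q * u q = cnj (u p) * H p q * u q - cnj (u p) * H p i * (H i q * u q) / ?h" for p q
      by (simp add: H'_def algebra_simps)
    then show ?thesis
      by (simp add: S_def A_def B_def sum_subtractf sum_product sum_divide_distrib)
  qed
  have a': "(\<Sum>p\<in>I. a' p * u p) = (\<Sum>p\<in>I. a p * u p) - a i * B u / ?h" for u
  proof -
    have "a' p * u p = a p * u p - a i * (H i p * u p) / ?h" for p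
      by (simp add: a'_def algebra_simps)
    then show ?thesis
      by (simp add: B_def sum_subtractf sum_distrib_left sum_divide_distrib)
  qed
  have b': "(\<Sum>p\<in>I. b' p * cnj (u p)) = (\<Sum>p\<in>I. b p * cnj (u p)) - A u * b i / ?h" for u
  proof -
    have "b' p * cnj (u p) = b p * cnj (u p) - cnj (u p) * H p i * b i / ?h" for p
      by (simp add: b'_def algebra_simps)
    then show ?thesis
      by (simp add: A_def sum_subtractf sum_distrib_right sum_divide_distrib)
  qed
  have pos': "c * (\<Sum>p\<in>I. (norm (u p))\<^sup>2) \<le> Re (\<Sum>p\<in>I. \<Sum>q\<in>I. cnj (u p) * H' p q * u q)" for u
  proof -
    \<comment> \<open>For this value of the eliminated coordinate the factor of \<open>cnj w\<close>
      in the full form vanishes, and what is left is exactly the Schur complement form. Dropping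
      |w|^2 on the other side gives its coercivity.\<close>
    define w where "w = - B u / ?h"
    have hw: "?h * w = - B u" using h0 by (simp add: w_def)
    have "(\<Sum>p\<in>insert i I. \<Sum>q\<in>insert i I. cnj ((u(i := w)) p) * H p q * (u(i := w)) q)
       = cnj w * (?h * w + B u) + A u * w + S u"
      unfolding quad by (simp add: A_def B_def algebra_simps)
    also have "\<dots> = S u - A u * B u / ?h"
      unfolding hw by (simp add: w_def)
    finally have "c * (\<Sum>p\<in>insert i I. (norm ((u(i := w)) p))\<^sup>2) \<le> Re (S u - A u * B u / ?h)"
      using insert.prems(2)[of "u(i := w)"] by simp
    moreover have "(\<Sum>p\<in>I. (norm (u p))\<^sup>2) \<le> (\<Sum>p\<in>insert i I. (norm ((u(i := w)) p))\<^sup>2)"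
      using updr[where f = "\<lambda>_ z. (norm z)\<^sup>2" and u = u and w = w] by (simp add: splitr)
    ultimately show ?thesis
      unfolding H' using insert.prems(1) by (meson mult_left_mono less_imp_le order_trans)
  qed
  have Bx: "B x = b i - ?h * x i"
    using insert.prems(3)[of i] by (simp add: split B_def eq_diff_eq add.commute)
  have sol': "(\<Sum>q\<in>I. H' p q * x q) = b' p" if "p \<in> I" for p
  proof -
    have "H' p q * x q = H p q * x q - H p i * (H i q * x q) / ?h" for q
      by (simp add: H'_def algebra_simps)
    then have "(\<Sum>q\<in>I. H' p q * x q) = (\<Sum>q\<in>I. H p q * x q) - H p i * B x / ?h"
      by (simp add: B_def sum_subtractf sum_distrib_left sum_divide_distrib)
    also have "(\<Sum>q\<in>I. H p q * x q) = b p - H p i * x i"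
      using insert.prems(3)[of p] that by (simp add: split eq_diff_eq add.commute)
    finally show ?thesis
      unfolding Bx b'_def using h0 by (simp add: field_simps)
  qed
  let ?E = "\<lambda>u. - (\<Sum>p\<in>insert i I. \<Sum>q\<in>insert i I. cnj (u p) * H p q * u q) + (\<Sum>p\<in>insert i I. a p * u p) + (\<Sum>p\<in>insert i I. b p * cnj (u p))"
  let ?E' = "\<lambda>u. - (\<Sum>p\<in>I. \<Sum>q\<in>I. cnj (u p) * H' p q * u q) + (\<Sum>p\<in>I. a' p * u p) + (\<Sum>p\<in>I. b' p * cnj (u p))"
  define C where "C = of_real (pi / \<kappa>) / ?h * exp (of_real \<kappa> * (a i * b i / ?h))"
  have inner: "(\<integral>w. exp (of_real \<kappa> * ?E (u(i := w))) \<partial>lborel) = C * exp (of_real \<kappa> * ?E' u)" for u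
  proof -
    define K where "K = - S u + (\<Sum>p\<in>I. a p * u p) + (\<Sum>p\<in>I. b p * cnj (u p))"
    define s where "s = of_real \<kappa> * (a i - A u)"
    define t where "t = of_real \<kappa> * (b i - B u)"
    have E: "of_real \<kappa> * ?E (u(i := w)) = (- (of_real \<kappa> * ?h) * (cnj w * w) + s * w + t * cnj w) + of_real \<kappa> * K" for w
      unfolding quad unfolding split upd[where f = "\<lambda>p z. a p * z"] upd[where f = "\<lambda>p z. b p * cnj z"]
      by (simp add: K_def s_def t_def A_def B_def algebra_simps)
    have "(\<integral>w. exp (of_real \<kappa> * ?E (u(i := w))) \<partial>lborel)
       = of_real pi / (of_real \<kappa> * ?h) * exp (s * t / (of_real \<kappa> * ?h)) * exp (of_real \<kappa> * K)"
      unfolding E exp_add[of _ "of_real \<kappa> * K"]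
      using has_bochner_integral_complex_plane_gaussian[of "of_real \<kappa> * ?h" s t] h0 \<kappa>
      by (simp add: has_bochner_integral_iff)
    also have "\<dots> = of_real (pi / \<kappa>) / ?h * exp (s * t / (of_real \<kappa> * ?h) + of_real \<kappa> * K)"
      by (simp add: exp_add)
    also have "s * t / (of_real \<kappa> * ?h) + of_real \<kappa> * K = of_real \<kappa> * (a i * b i / ?h) + of_real \<kappa> * ?E' u"
      unfolding H' a' b' K_def s_def t_def using h0 \<kappa> by (simp add: field_simps)
    finally show ?thesis
      by (simp add: C_def exp_add)
  qed
  have "(\<integral>u. exp (of_real \<kappa> * ?E u) \<partial>Pi\<^sub>M (insert i I) (\<lambda>_. lborel))
      = (\<integral>u. \<integral>w. exp (of_real \<kappa> * ?E (u(i := w))) \<partial>lborel \<partial>Pi\<^sub>M I (\<lambda>_. lborel))"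
    by (rule product_integral_insert[OF insert.hyps(1,2) integrable_gaussian_PiM[OF _ \<kappa> insert.prems(1,2)]])
      (simp add: insert.hyps)
  also have "\<dots> = C * (\<integral>u. exp (of_real \<kappa> * ?E' u) \<partial>Pi\<^sub>M I (\<lambda>_. lborel))"
    unfolding inner by simp
  also have "\<dots> = C * (of_real (pi / \<kappa>) ^ card I / det (pad_matrix I H') * exp (of_real \<kappa> * (\<Sum>p\<in>I. a' p * x p)))"
    using insert.IH[OF insert.prems(1) pos' sol'] by simp
  also have "\<dots> = of_real (pi / \<kappa>) ^ card (insert i I) / (?h * det (pad_matrix I H'))
       * exp (of_real \<kappa> * (a i * b i / ?h) + of_real \<kappa> * (\<Sum>p\<in>I. a' p * x p))"
    using insert.hyps by (simp add: C_def exp_add mult_ac)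
  also have "of_real \<kappa> * (a i * b i / ?h) + of_real \<kappa> * (\<Sum>p\<in>I. a' p * x p) = of_real \<kappa> * (\<Sum>p\<in>insert i I. a p * x p)"
    unfolding a' Bx split using h0 by (simp add: field_simps)
  also have "?h * det (pad_matrix I H') = det (pad_matrix (insert i I) H)"
    using det_pad_matrix_insert[where H = H, OF insert.hyps(2) h0(1)] by (simp add: H'_def)
  finally show ?case .
qed

lemma norm_vec_power2: "(norm (u :: complex ^ 'n))\<^sup>2 = (\<Sum>i\<in>UNIV. (norm (u $ i))\<^sup>2)"
  by (simp add: norm_vec_def L2_set_def sum_nonneg)

lemma has_bochner_integral_gaussian_lborel:
  fixes H :: "complex ^ 'n ^ 'n" and \<kappa> :: real
  assumes \<kappa>: "\<kappa> > 0" and c: "c > 0"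
    and pos: "\<And>u. c * (norm u)\<^sup>2 \<le> Re (cdot (vcnj u) (H *v u))"
    and sol: "H *v x = b"
  shows "has_bochner_integral lborel
           (\<lambda>u. exp (of_real \<kappa> * (- cdot (vcnj u) (H *v u) + cdot a u + cdot b (vcnj u))))
           (of_real (pi / \<kappa>) ^ CARD('n) / det H * exp (of_real \<kappa> * cdot a x))"
proof -
  define F where "F = (\<lambda>u::complex ^ 'n. exp (of_real \<kappa> * (- cdot (vcnj u) (H *v u) + cdot a u + cdot b (vcnj u))))"
  have quad: "cdot (vcnj u) (H *v u) = (\<Sum>p\<in>UNIV. \<Sum>q\<in>UNIV. cnj (u $ p) * H $ p $ q * u $ q)" for u
    by (simp add: cdot_def vcnj_def matrix_vector_mult_def sum_distrib_left mult.assoc)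
  have F: "F (\<chi> i. f i) = exp (of_real \<kappa> * (- (\<Sum>p\<in>UNIV. \<Sum>q\<in>UNIV. cnj (f p) * H $ p $ q * f q)
      + (\<Sum>p\<in>UNIV. a $ p * f p) + (\<Sum>p\<in>UNIV. b $ p * cnj (f p))))" for f
    unfolding F_def quad by (simp add: cdot_def vcnj_def)
  have pos': "c * (\<Sum>p\<in>UNIV. (norm (f p))\<^sup>2) \<le> Re (\<Sum>p\<in>UNIV. \<Sum>q\<in>UNIV. cnj (f p) * H $ p $ q * f q)" for f
    using pos[of "\<chi> i. f i"] unfolding quad norm_vec_power2 by simp
  have sol': "(\<Sum>q\<in>UNIV. H $ p $ q * x $ q) = b $ p" for p
    using sol by (auto simp: matrix_vector_mult_def)
  have pad: "pad_matrix UNIV (\<lambda>p q. H $ p $ q) = H"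
    by (simp add: pad_matrix_def)
  have "has_bochner_integral (\<Pi>\<^sub>M i\<in>UNIV. lborel) (\<lambda>f. F (\<chi> i. f i))
      (of_real (pi / \<kappa>) ^ CARD('n) / det H * exp (of_real \<kappa> * cdot a x))"
    unfolding has_bochner_integral_iff F
    using integrable_gaussian_PiM[OF _ \<kappa> c pos'] integral_gaussian_PiM[OF \<kappa> c pos' sol']
    by (simp add: pad cdot_def)
  moreover have "F \<in> borel_measurable borel"
    unfolding F_def quad cdot_def vcnj_def
    by (intro borel_measurable_continuous_onI continuous_intros)
  moreover have "(\<lambda>f. \<chi> i. f i) \<in> (\<Pi>\<^sub>M i\<in>UNIV. lborel) \<rightarrow>\<^sub>M (borel :: (complex ^ 'n) measure)"
    by (rule measurable_vec_lambda_PiM)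
  ultimately show ?thesis
    unfolding F_def[symmetric] by (subst lborel_complex_vec_eq_distr) (rule has_bochner_integral_distr)
qed

text \<open>For \<kappa> = lam / 2 the constant in \<open>dm\<close> is the inverse of (pi /
  \<kappa>)^n, so 1 / det H is the whole prefactor.\<close>

lemma has_bochner_integral_gaussian_dm:
  fixes H :: "complex ^ 'n ^ 'n"
  assumes lam: "lam > 0" and c: "c > 0"
    and pos: "\<And>u. c * (norm u)\<^sup>2 \<le> Re (cdot (vcnj u) (H *v u))"
    and sol: "H *v x = b"
  shows "has_bochner_integral (dm lam)
           (\<lambda>u. exp (of_real lam / 2 * (- cdot (vcnj u) (H *v u) + cdot a u + cdot b (vcnj u))))
           (inverse (det H) * exp (of_real lam / 2 * cdot a x))"
proof -
  define F where "F = (\<lambda>u::complex ^ 'n. exp (of_real lam / 2 * (- cdot (vcnj u) (H *v u) + cdot a u + cdot b (vcnj u))))"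
  have "has_bochner_integral lborel F (of_real (pi / (lam / 2)) ^ CARD('n) / det H * exp (of_real lam / 2 * cdot a x))"
    using has_bochner_integral_gaussian_lborel[OF _ c pos sol, of "lam / 2" a] lam by (simp add: F_def)
  note F = this
  then have "has_bochner_integral lborel (\<lambda>u. ((lam / (2 * pi)) ^ CARD('n)) *\<^sub>R F u)
     (((lam / (2 * pi)) ^ CARD('n)) *\<^sub>R (of_real (pi / (lam / 2)) ^ CARD('n) / det H * exp (of_real lam / 2 * cdot a x)))"
    by (intro has_bochner_integral_scaleR_right)
  also have "((lam / (2 * pi)) ^ CARD('n)) *\<^sub>R (of_real (pi / (lam / 2)) ^ CARD('n) / det H * exp (of_real lam / 2 * cdot a x))
     = inverse (det H) * exp (of_real lam / 2 * cdot a x)"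
  proof -
    have "(lam / (2 * pi)) ^ CARD('n) * (pi / (lam / 2)) ^ CARD('n) = 1"
      using lam by (simp add: power_mult_distrib[symmetric])
    then have "of_real ((lam / (2 * pi)) ^ CARD('n)) * of_real (pi / (lam / 2)) ^ CARD('n) = (1 :: complex)"
      by (metis of_real_1 of_real_mult of_real_power)
    then have "of_real ((lam / (2 * pi)) ^ CARD('n)) * of_real (pi / (lam / 2)) ^ CARD('n) * X = X" for X :: complex
      by (simp only: mult_1)
    then show ?thesis
      by (simp only: scaleR_conv_of_real divide_inverse mult.assoc)
  qed
  finally show ?thesis
    unfolding dm_def F_def[symmetric] using lam
    by (intro has_bochner_integral_density borel_measurable_has_bochner_integral[OF F]) auto
qed

section \<open>Conjugation of the last q coordinates\<close>

definition flip :: "complex ^ ('p::finite + 'q::finite) \<Rightarrow> complex ^ ('p + 'q)"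
  where "flip z = vjoin (vfst z) (vcnj (vsnd z))"

lemma flip_flip [simp]: "flip (flip z) = z"
  by (auto simp: flip_def vjoin_def vfst_def vsnd_def vcnj_def vec_eq_iff split: sum.split)

lemma continuous_on_flip [continuous_intros]: "continuous_on UNIV flip"
proof -
  have "continuous_on UNIV (\<lambda>z. flip z $ i)" for i
    by (cases i) (auto simp: flip_def vjoin_def vfst_def vsnd_def vcnj_def intro!: continuous_intros)
  then have "continuous_on UNIV (\<lambda>z. \<chi> i. flip z $ i)" by (rule continuous_on_vec_lambda)
  then show ?thesis by simp
qed

text \<open>\<open>flip\<close> is only real-linear, but diagonal in the real basis: it changes the
  sign exactly of the imaginary directions in the last block, so its Jacobian has absolute value
  1.\<close>

lemma lborel_eq_distr_flip: "(lborel :: (complex ^ ('p::finite + 'q::finite)) measure) = distr lborel borel flip"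
proof -
  define c :: "complex ^ ('p + 'q) \<Rightarrow> real" where "c b = (if \<exists>j. b = axis (Inr j) \<i> then -1 else 1)" for b
  have inj: "axis i a = axis j b \<longleftrightarrow> i = j \<and> a = b" if "a \<noteq> 0" "b \<noteq> 0" for i j :: "'p + 'q" and a b :: complex
    using that by (auto simp: axis_eq_axis)
  have "0 + (\<Sum>b\<in>Basis. (c b * (x \<bullet> b)) *\<^sub>R b) = flip x" for x
  proof (rule euclidean_eqI)
    fix b :: "complex ^ ('p + 'q)" assume b: "b \<in> Basis"
    then obtain i e where ie: "b = axis i e" "e = 1 \<or> e = \<i>" by (auto simp: Basis_vec_def Basis_complex_def)
    have "(0 + (\<Sum>b\<in>Basis. (c b * (x \<bullet> b)) *\<^sub>R b)) \<bullet> b = c b * (x \<bullet> b)"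
      using b by simp
    also have "\<dots> = flip x \<bullet> b"
      using ie(2) unfolding ie(1) c_def
      by (cases i) (auto simp: inj inner_axis flip_def vjoin_def vfst_def vsnd_def vcnj_def)
    finally show "(0 + (\<Sum>b\<in>Basis. (c b * (x \<bullet> b)) *\<^sub>R b)) \<bullet> b = flip x \<bullet> b" .
  qed
  then have T: "(\<lambda>x. 0 + (\<Sum>b\<in>Basis. (c b * (x \<bullet> b)) *\<^sub>R b)) = flip" by auto
  have "(\<Prod>b\<in>Basis. \<bar>c b\<bar>) = 1" by (rule prod.neutral) (simp add: c_def)
  moreover have "lborel = density (distr lborel borel (\<lambda>x. 0 + (\<Sum>b\<in>Basis. (c b * (x \<bullet> b)) *\<^sub>R b))) (\<lambda>_. (\<Prod>b\<in>Basis. \<bar>c b\<bar>))"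
    by (rule lborel_affine_euclidean) (simp add: c_def)
  ultimately show ?thesis
    unfolding T by (simp add: density_1)
qed

lemma has_bochner_integral_dm_flip:
  fixes f :: "complex ^ ('p::finite + 'q::finite) \<Rightarrow> complex"
  assumes "has_bochner_integral (dm lam) (\<lambda>u. f (flip u)) I"
  shows "has_bochner_integral (dm lam) f I"
proof -
  have flip [measurable]: "flip \<in> borel \<rightarrow>\<^sub>M (borel :: (complex ^ ('p + 'q)) measure)"
    by (intro borel_measurable_continuous_onI continuous_intros)
  have "dm lam = distr (dm lam) borel (flip :: complex ^ ('p + 'q) \<Rightarrow> _)"
    unfolding dm_def by (subst lborel_eq_distr_flip, subst density_distr) auto
  \<comment> \<open>The hypothesis only gives measurability of \<open>f\<close> composed with
    \<open>flip\<close>; composing once more with the involution recovers \<open>f\<close>.\<close>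
  moreover have "f \<in> borel_measurable borel"
  proof -
    have "(\<lambda>u. f (flip u)) \<in> borel_measurable borel"
      using borel_measurable_has_bochner_integral[OF assms] by (simp add: dm_def)
    from measurable_compose[OF flip this] show ?thesis by simp
  qed
  moreover have "flip \<in> dm lam \<rightarrow>\<^sub>M (borel :: (complex ^ ('p + 'q)) measure)"
    using flip by (simp add: dm_def)
  ultimately show ?thesis
    using assms by (metis has_bochner_integral_distr)
qed

section \<open>Block matrices\<close>

lemma sum_UNIV_Plus: "(\<Sum>i\<in>UNIV. f i) = (\<Sum>i\<in>UNIV. f (Inl i)) + (\<Sum>j\<in>UNIV. f (Inr j))"
  for f :: "'p::finite + 'q::finite \<Rightarrow> 'a::comm_monoid_add"
  unfolding UNIV_Plus_UNIV[symmetric] by (subst sum.Plus) auto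

lemma vjoin_nth [simp]: "vjoin u v $ Inl i = u $ i" "vjoin u v $ Inr j = v $ j"
  by (simp_all add: vjoin_def)

lemma vfst_nth [simp]: "vfst z $ i = z $ Inl i"
  by (simp add: vfst_def)

lemma vsnd_nth [simp]: "vsnd z $ j = z $ Inr j"
  by (simp add: vsnd_def)

lemma vcnj_nth [simp]: "vcnj u $ i = cnj (u $ i)"
  by (simp add: vcnj_def)

lemma vec_eq_iff_Plus: "x = y \<longleftrightarrow> (\<forall>i. x $ Inl i = y $ Inl i) \<and> (\<forall>j. x $ Inr j = y $ Inr j)"
  for x y :: "'a ^ ('p::finite + 'q::finite)"
  unfolding vec_eq_iff by (metis sum.exhaust)

lemma vjoin_vfst_vsnd [simp]: "vjoin (vfst z) (vsnd z) = z"
  by (simp add: vec_eq_iff_Plus)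

lemma vfst_vjoin [simp]: "vfst (vjoin u v) = u"
  and vsnd_vjoin [simp]: "vsnd (vjoin u v) = v"
  by (simp_all add: vec_eq_iff)

lemma vjoin_eq_iff [simp]: "vjoin u v = vjoin u' v' \<longleftrightarrow> u = u' \<and> v = v'"
  by (metis vfst_vjoin vsnd_vjoin)

lemma vjoin_eq_0_iff: "vjoin u v = 0 \<longleftrightarrow> u = 0 \<and> v = 0"
  by (auto simp: vec_eq_iff_Plus vec_eq_iff)

lemma vjoin_arith:
  fixes u u' :: "'a::ab_group_add ^ 'p::finite" and v v' :: "'a ^ 'q::finite"
  shows "vjoin u v + vjoin u' v' = vjoin (u + u') (v + v')"
    and "vjoin u v - vjoin u' v' = vjoin (u - u') (v - v')"
    and "- vjoin u v = vjoin (- u) (- v)"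
  by (simp_all add: vec_eq_iff_Plus)

lemma vfst_arith [simp]:
  fixes u v :: "'a::ab_group_add ^ ('p::finite + 'q::finite)"
  shows "vfst (u + v) = vfst u + vfst v" "vfst (u - v) = vfst u - vfst v"
  by (simp_all add: vec_eq_iff)

lemma vsnd_arith [simp]:
  fixes u v :: "'a::ab_group_add ^ ('p::finite + 'q::finite)"
  shows "vsnd (u + v) = vsnd u + vsnd v" "vsnd (u - v) = vsnd u - vsnd v"
  by (simp_all add: vec_eq_iff)

lemma vcnj_arith [simp]:
  "vcnj (u + v) = vcnj u + vcnj v" "vcnj (u - v) = vcnj u - vcnj v" "vcnj (- u) = - vcnj u" "vcnj (vcnj u) = u"
  "vcnj 0 = 0"
  by (simp_all add: vec_eq_iff)

lemma vcnj_vjoin: "vcnj (vjoin u v) = vjoin (vcnj u) (vcnj v)"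
  by (simp add: vec_eq_iff_Plus)

lemma cdot_vjoin: "cdot (vjoin u v) (vjoin u' v') = cdot u u' + cdot v v'"
  by (simp add: cdot_def sum_UNIV_Plus)

lemma cdot_vfst_vsnd: "cdot u v = cdot (vfst u) (vfst v) + cdot (vsnd u) (vsnd v)"
  by (metis cdot_vjoin vjoin_vfst_vsnd)

lemma cdot_arith:
  "cdot (u + v) w = cdot u w + cdot v w" "cdot (u - v) w = cdot u w - cdot v w" "cdot (- u) w = - cdot u w"
  "cdot w (u + v) = cdot w u + cdot w v" "cdot w (u - v) = cdot w u - cdot w v" "cdot w (- u) = - cdot w u"
  by (simp_all add: cdot_def algebra_simps sum.distrib sum_subtractf sum_negf)

lemma cdot_commute: "cdot u v = cdot v u"
  by (simp add: cdot_def mult.commute)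

lemma cdot_cmult: "cdot u (c *s v) = c * cdot u v" "cdot (c *s u) v = c * cdot u v"
  by (simp_all add: cdot_def sum_distrib_left mult_ac)

lemma cdot_transpose: "cdot (transpose A *v u) v = cdot u (A *v v)"
proof -
  have "cdot (transpose A *v u) v = (\<Sum>j\<in>UNIV. \<Sum>i\<in>UNIV. A $ i $ j * u $ i * v $ j)"
    by (simp add: cdot_def matrix_vector_mult_def transpose_def sum_distrib_right del: transpose_matrix_vector)
  also have "\<dots> = (\<Sum>i\<in>UNIV. \<Sum>j\<in>UNIV. A $ i $ j * u $ i * v $ j)" by (rule sum.swap)
  also have "\<dots> = cdot u (A *v v)"
    by (simp add: cdot_def matrix_vector_mult_def sum_distrib_left mult_ac)
  finally show ?thesis .
qed

lemma cdot_vcnj_self: "cdot (vcnj u) u = of_real ((norm u)\<^sup>2)"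
  by (simp add: cdot_def norm_vec_power2 mult.commute[of "cnj _"] flip: complex_norm_square)

lemma cnj_cdot: "cnj (cdot u v) = cdot (vcnj u) (vcnj v)"
  by (simp add: cdot_def)

lemma norm_vjoin: "(norm (vjoin u v))\<^sup>2 = (norm u)\<^sup>2 + (norm v)\<^sup>2" for u :: "complex ^ 'p" and v :: "complex ^ 'q"
  by (simp add: norm_vec_power2 sum_UNIV_Plus)

lemma norm_vcnj [simp]: "norm (vcnj u) = norm u"
  by (simp add: norm_vec_def)

lemma norm_cdot_le: "norm (cdot u v) \<le> norm u * norm v"
proof -
  have "norm (cdot u v) \<le> (\<Sum>i\<in>UNIV. \<bar>norm (u $ i)\<bar> * \<bar>norm (v $ i)\<bar>)"
    unfolding cdot_def by (rule sum_norm_le) (simp add: norm_mult)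
  also have "\<dots> \<le> norm u * norm v"
    unfolding norm_vec_def by (rule L2_set_mult_ineq)
  finally show ?thesis .
qed

lemma vcnj_matrix_vector: "vcnj (A *v u) = mcnj A *v vcnj u"
  by (simp add: vec_eq_iff mcnj_def matrix_vector_mult_def)

lemma block_nth [simp]:
  "block A B C D $ Inl i $ Inl j = A $ i $ j" "block A B C D $ Inl i $ Inr k = B $ i $ k"
  "block A B C D $ Inr l $ Inl j = C $ l $ j" "block A B C D $ Inr l $ Inr k = D $ l $ k"
  by (simp_all add: block_def)

lemma blk_block [simp]:
  "blk11 (block A B C D) = A" "blk12 (block A B C D) = B" "blk21 (block A B C D) = C" "blk22 (block A B C D) = D"
  by (simp_all add: vec_eq_iff blk11_def blk12_def blk21_def blk22_def)

lemma matrix_eq_iff_Plus: "M = N \<longleftrightarrow> blk11 M = blk11 N \<and> blk12 M = blk12 N \<and> blk21 M = blk21 N \<and> blk22 M = blk22 N"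
  unfolding vec_eq_iff_Plus[of M N] vec_eq_iff_Plus[of "M $ _" "N $ _"]
  by (auto simp: vec_eq_iff blk11_def blk12_def blk21_def blk22_def)

lemma block_blk [simp]: "block (blk11 N) (blk12 N) (blk21 N) (blk22 N) = N"
  by (simp add: matrix_eq_iff_Plus)

lemma block_eq_iff: "block A B C D = block A' B' C' D' \<longleftrightarrow> A = A' \<and> B = B' \<and> C = C' \<and> D = D'"
  by (metis blk_block)

lemma mat_eq_block: "mat c = block (mat c) 0 0 (mat c)"
  by (simp add: vec_eq_iff_Plus mat_def)

lemma transpose_uminus: "transpose (- X) = - transpose X" for X :: "complex ^ 'm ^ 'n"
  by (simp add: vec_eq_iff transpose_def)

lemma transpose_add: "transpose (X + Y) = transpose X + transpose Y" for X Y :: "complex ^ 'm ^ 'n"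
  by (simp add: vec_eq_iff transpose_def)

lemma transpose_zero: "transpose (0 :: complex ^ 'm ^ 'n) = 0"
  by (simp add: vec_eq_iff transpose_def)

lemma transpose_block: "transpose (block A B C D) = block (transpose A) (transpose C) (transpose B) (transpose D)"
  by (simp add: vec_eq_iff_Plus transpose_def)

lemma mcnj_block: "mcnj (block A B C D) = block (mcnj A) (mcnj B) (mcnj C) (mcnj D)"
  by (simp add: vec_eq_iff_Plus mcnj_def)

lemma cadj_block: "cadj (block A B C D) = block (cadj A) (cadj C) (cadj B) (cadj D)"
  by (simp add: cadj_def transpose_block mcnj_block)

lemma block_mult_vjoin:
  fixes A :: "'a::semiring_1 ^ 'c::finite ^ 'r::finite" and D :: "'a ^ 'd::finite ^ 's::finite"
  shows "block A B C D *v vjoin u v = vjoin (A *v u + B *v v) (C *v u + D *v v)"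
  by (simp add: vec_eq_iff_Plus matrix_vector_mult_def sum_UNIV_Plus)

lemma block_mult_block:
  fixes A :: "'a::semiring_1 ^ 'c::finite ^ 'r::finite" and D :: "'a ^ 'd::finite ^ 's::finite"
  shows "block A B C D ** block A' B' C' D' = block (A ** A' + B ** C') (A ** B' + B ** D') (C ** A' + D ** C') (C ** B' + D ** D')"
  by (simp add: vec_eq_iff_Plus matrix_matrix_mult_def sum_UNIV_Plus)

lemma matrix_mult_arith:
  fixes A A' :: "complex ^ 'm ^ 'n" and B B' :: "complex ^ 'k ^ 'm"
  shows "A ** (B + B') = A ** B + A ** B'" "(A + A') ** B = A ** B + A' ** B"
    "A ** (B - B') = A ** B - A ** B'" "(A - A') ** B = A ** B - A' ** B"
    "(- A) ** B = - (A ** B)" "A ** (- B) = - (A ** B)" "A ** 0 = 0" "0 ** B = 0"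
  by (simp_all add: vec_eq_iff matrix_matrix_mult_def algebra_simps sum.distrib sum_subtractf sum_negf)

lemma matrix_vector_mult_uminus:
  fixes A :: "complex ^ 'm ^ 'n"
  shows "(- A) *v u = - (A *v u)" "A *v (- u) = - (A *v u)"
  by (simp_all add: vec_eq_iff matrix_vector_mult_def sum_negf)

lemma cadj_mult: "cadj (A ** B) = cadj B ** cadj A"
  by (simp add: vec_eq_iff cadj_def mcnj_def transpose_def matrix_matrix_mult_def mult.commute)

lemma cadj_arith:
  "cadj (cadj A) = A" "cadj (A - A') = cadj A - cadj A'" "cadj (- A) = - cadj A" "cadj (mat 1) = mat 1"
  by (auto simp: vec_eq_iff cadj_def mcnj_def transpose_def mat_def)

lemma cadj_alt: "cadj A = transpose (mcnj A)"
  by (simp add: vec_eq_iff cadj_def mcnj_def transpose_def)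

lemma cdot_cadj: "cdot (vcnj u) (A *v v) = cdot (vcnj (cadj A *v u)) v"
proof -
  have "mcnj (cadj A) = transpose A"
    by (simp add: vec_eq_iff cadj_def mcnj_def transpose_def)
  then show ?thesis by (simp only: vcnj_matrix_vector cdot_transpose)
qed

lemma matrix_inv_unique:
  assumes "A ** B = mat 1" "B ** A = mat 1"
  shows "matrix_inv A = B"
proof -
  have "A ** matrix_inv A = mat 1 \<and> matrix_inv A ** A = mat 1"
    unfolding matrix_inv_def by (rule someI_ex) (use assms in blast)
  then show ?thesis
    by (metis assms(2) matrix_mul_assoc matrix_mul_lid matrix_mul_rid)
qed

lemma matrix_inv_invertible:
  assumes "invertible A"
  shows "A ** matrix_inv A = mat 1" "matrix_inv A ** A = mat 1"
  using assms matrix_inv_unique unfolding invertible_def by metis+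

lemma matrix_inv_square_unique:
  fixes A B :: "complex ^ 'n ^ 'n"
  assumes "A ** B = mat 1"
  shows "matrix_inv A = B"
  using assms matrix_left_right_inverse[of A B] by (intro matrix_inv_unique) auto

lemma matrix_inv_transpose:
  fixes A :: "complex ^ 'n ^ 'n"
  assumes "invertible A"
  shows "matrix_inv (transpose A) = transpose (matrix_inv A)"
  by (rule matrix_inv_square_unique)
     (metis assms matrix_inv_invertible(2) matrix_transpose_mul transpose_mat)

lemma invertible_iff_ker:
  fixes A :: "complex ^ 'n ^ 'n"
  shows "invertible A \<longleftrightarrow> (\<forall>x. A *v x = 0 \<longrightarrow> x = 0)"
  unfolding invertible_left_inverse matrix_left_invertible_ker ..

section \<open>Determinants of block triangular matrices\<close>

text \<open>Leibniz expansion: a permutation that moves some \<open>Inr j\<close> meets an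
  off-diagonal zero in that row. The surviving permutations live on \<open>range Inl\<close> and
  correspond, with equal sign, to the permutations of the smaller index type.\<close>

lemma det_block_diag_one:
  fixes P :: "complex ^ 'p::finite ^ 'p"
  shows "det (block P 0 0 (mat 1) :: complex ^ ('p + 'q::finite) ^ ('p + 'q)) = det P"
proof -
  let ?X = "block P 0 0 (mat 1) :: complex ^ ('p + 'q) ^ ('p + 'q)"
  let ?f = "\<lambda>\<pi> :: 'p + 'q \<Rightarrow> 'p + 'q. of_int (sign \<pi>) * (\<Prod>i\<in>UNIV. ?X $ i $ \<pi> i)"
  have "det ?X = (\<Sum>\<pi> | \<pi> permutes UNIV. ?f \<pi>)" by (simp add: det_def)
  also have "\<dots> = (\<Sum>\<pi> | \<pi> permutes range Inl. ?f \<pi>)"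
  proof (rule sum.mono_neutral_right)
    show "{\<pi>. \<pi> permutes range Inl} \<subseteq> {\<pi>. \<pi> permutes (UNIV :: ('p + 'q) set)}"
      using permutes_subset by blast
    show "\<forall>\<pi>\<in>{\<pi>. \<pi> permutes (UNIV :: ('p + 'q) set)} - {\<pi>. \<pi> permutes range Inl}. ?f \<pi> = 0"
    proof
      fix \<pi> assume pi: "\<pi> \<in> {\<pi>. \<pi> permutes (UNIV :: ('p + 'q) set)} - {\<pi>. \<pi> permutes range Inl}"
      then have "\<exists>i. i \<notin> range Inl \<and> \<pi> i \<noteq> i"
        unfolding permutes_def by auto
      then obtain j where j: "\<pi> (Inr j) \<noteq> Inr j" by (metis rangeI sum.exhaust)
      have "?X $ Inr j $ \<pi> (Inr j) = 0"
        using j by (cases "\<pi> (Inr j)") (auto simp: mat_def)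
      then show "?f \<pi> = 0" by (auto intro!: prod_zero)
    qed
  qed simp
  also have "\<dots> = (\<Sum>\<pi> | \<pi> permutes (UNIV :: 'p set). ?f (map_permutation UNIV Inl \<pi>))"
  proof (rule sum.reindex_bij_betw[symmetric])
    have "bij_betw (\<lambda>\<pi> x. if x \<in> range Inl then Inl (\<pi> (inv_into UNIV Inl x)) else x)
        {\<pi>. \<pi> permutes (UNIV :: 'p set)} {\<pi>. \<pi> permutes (range Inl :: ('p + 'q) set)}"
      by (intro bij_betw_permutations) (simp add: bij_betw_def)
    moreover have "map_permutation UNIV Inl \<pi> = (\<lambda>x. if x \<in> range Inl then Inl (\<pi> (inv_into UNIV Inl x)) else (x :: 'p + 'q))" for \<pi>
      by (auto simp: map_permutation_def restrict_id_def fun_eq_iff)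
    ultimately show "bij_betw (map_permutation UNIV Inl) {\<pi>. \<pi> permutes (UNIV :: 'p set)} {\<pi>. \<pi> permutes (range Inl :: ('p + 'q) set)}"
      by (simp cong: bij_betw_cong)
  qed
  also have "\<dots> = (\<Sum>\<pi> | \<pi> permutes (UNIV :: 'p set). of_int (sign \<pi>) * (\<Prod>i\<in>UNIV. P $ i $ \<pi> i))"
  proof (rule sum.cong)
    fix \<pi> assume "\<pi> \<in> {\<pi>. \<pi> permutes (UNIV :: 'p set)}"
    then have pi: "\<pi> permutes UNIV" by simp
    have 1: "map_permutation UNIV Inl \<pi> (Inl i) = (Inl (\<pi> i) :: 'p + 'q)" for i
      by (rule map_permutation_apply) auto
    have 2: "map_permutation UNIV Inl \<pi> (Inr j) = (Inr j :: 'p + 'q)" for j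
      by (auto simp: map_permutation_def restrict_id_def)
    have "(\<Prod>i\<in>UNIV. ?X $ i $ map_permutation UNIV Inl \<pi> i) = (\<Prod>i\<in>UNIV. P $ i $ \<pi> i)"
      unfolding UNIV_Plus_UNIV[symmetric] by (subst prod.Plus) (simp_all add: 1 2 mat_def)
    moreover have "sign (map_permutation UNIV Inl \<pi> :: 'p + 'q \<Rightarrow> _) = sign \<pi>"
      using pi by (intro sign_map_permutation) auto
    ultimately show "?f (map_permutation UNIV Inl \<pi>) = of_int (sign \<pi>) * (\<Prod>i\<in>UNIV. P $ i $ \<pi> i)"
      by simp
  qed simp
  finally show ?thesis by (simp add: det_def)
qed

text \<open>Conjugation by \<open>block (mat 1) 0 0 (mat 2)\<close> shows \<open>d Y = d (2 Y) = (d Y)\<^sup>2\<close>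
  for the determinant \<open>d Y\<close> in question.\<close>

lemma det_block_lower_unit: "det (block (mat 1) 0 Y (mat 1)) = 1"
  for Y :: "complex ^ 'p::finite ^ 'q::finite"
proof -
  let ?L = "\<lambda>Y. block (mat 1) 0 Y (mat 1) :: complex ^ ('p + 'q) ^ ('p + 'q)"
  let ?S = "block (mat 1) 0 0 (mat 2) :: complex ^ ('p + 'q) ^ ('p + 'q)"
  let ?T = "block (mat 1) 0 0 (mat (1/2)) :: complex ^ ('p + 'q) ^ ('p + 'q)"
  have mat_mult: "(mat a :: complex ^ 'q ^ 'q) ** mat b = mat (a * b)" for a b
    by (simp add: vec_eq_iff matrix_matrix_mult_def mat_def mult_delta_left mult_delta_right)
  have mat2: "mat 2 ** Y = Y + Y"
    by (simp add: vec_eq_iff matrix_matrix_mult_def mat_def mult_delta_left mult_delta_right)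
  have add: "?L Y ** ?L Z = ?L (Y + Z)" for Y Z
    by (simp add: block_mult_block matrix_mult_arith)
  have "det (?S ** ?L Y ** ?T) = det (?L (Y + Y))"
    by (simp add: block_mult_block matrix_mult_arith mat_mult mat2)
  then have "det (?L Y) * (det ?S * det ?T) = det (?L (Y + Y))"
    by (simp only: det_mul mult_ac)
  moreover have "?S ** ?T = mat 1"
    by (simp add: block_mult_block matrix_mult_arith mat_mult mat_eq_block[symmetric])
  then have "det ?S * det ?T = 1" by (metis det_mul det_I)
  ultimately have "det (?L Y) = det (?L (Y + Y))" by simp
  also have "\<dots> = det (?L Y) * det (?L Y)" by (metis add det_mul)
  finally have "det (?L Y) = det (?L Y) * det (?L Y)" .
  moreover have "det (?L Y) * det (?L (- Y)) = 1"
    using add[of Y "- Y"] det_I by (simp add: mat_eq_block[symmetric] flip: det_mul)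
  ultimately show ?thesis by (metis mult_cancel_left1 mult_eq_0_iff zero_neq_one)
qed

lemma det_block_upper_unit: "det (block (mat 1) X 0 (mat 1)) = 1"
  for X :: "complex ^ 'q::finite ^ 'p::finite"
proof -
  have "transpose (0 :: complex ^ 'p ^ 'q) = 0" by (simp add: vec_eq_iff transpose_def)
  then show ?thesis
    using det_block_lower_unit[of "transpose X"] det_transpose[of "block (mat 1) X 0 (mat 1)"]
    by (simp add: transpose_block)
qed

section \<open>The Potapov--Ginzburg transform\<close>

locale su_block =
  fixes A :: "complex ^ 'p::finite ^ 'p" and B :: "complex ^ 'q::finite ^ 'p"
    and C :: "complex ^ 'p ^ 'q" and D :: "complex ^ 'q ^ 'q"
  assumes SU: "block A B C D \<in> SU"
begin

lemma J0_right: "block A B C D ** J0 ** cadj (block A B C D) = J0"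
  using SU by (simp add: SU_def)

text \<open>\<open>J0 ** cadj k ** J0\<close> is a right inverse of the square matrix k, hence a
  left inverse. \<open>J0_right\<close> relates the block rows of k, this one the block
  columns.\<close>

lemma J0_left: "cadj (block A B C D) ** J0 ** block A B C D = J0"
proof -
  let ?k = "block A B C D"
  have J: "J0 ** J0 = (mat 1 :: complex ^ ('p + 'q) ^ ('p + 'q))"
    by (simp add: J0_def block_mult_block matrix_mult_arith mat_eq_block[symmetric])
  have "?k ** (J0 ** cadj ?k ** J0) = mat 1"
    using J0_right J by (simp add: matrix_mul_assoc)
  then have "J0 ** cadj ?k ** J0 ** ?k = mat 1"
    by (simp add: matrix_left_right_inverse)
  then have "J0 ** (J0 ** cadj ?k ** J0 ** ?k) = J0" by simp
  then show ?thesis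
    by (simp add: matrix_mul_assoc J)
qed

lemma block_relations:
  shows "A ** cadj C = B ** cadj D" "D ** cadj D = mat 1 + C ** cadj C"
    "cadj A ** A = mat 1 + cadj C ** C" "cadj A ** B = cadj C ** D"
    "cadj B ** A = cadj D ** C" "cadj D ** D = mat 1 + cadj B ** B"
proof -
  have "block (A ** cadj A - B ** cadj B) (A ** cadj C - B ** cadj D) (C ** cadj A - D ** cadj B) (C ** cadj C - D ** cadj D)
      = block (mat 1) 0 0 (- mat 1)"
    using J0_right by (simp add: J0_def cadj_block block_mult_block matrix_mult_arith)
  then show "A ** cadj C = B ** cadj D" "D ** cadj D = mat 1 + C ** cadj C"
    by (simp_all add: block_eq_iff algebra_simps)
  have "block (cadj A ** A - cadj C ** C) (cadj A ** B - cadj C ** D) (cadj B ** A - cadj D ** C) (cadj B ** B - cadj D ** D)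
      = block (mat 1) 0 0 (- mat 1)"
    using J0_left by (simp add: J0_def cadj_block block_mult_block matrix_mult_arith)
  then show "cadj A ** A = mat 1 + cadj C ** C" "cadj A ** B = cadj C ** D"
    "cadj B ** A = cadj D ** C" "cadj D ** D = mat 1 + cadj B ** B"
    by (simp_all add: block_eq_iff algebra_simps)
qed

text \<open>Pairing with \<open>v\<close> turns the hypothesis into |X v|^2 = |v|^2 + |Y
  v|^2.\<close>

lemma cadj_self_mult_eq_0:
  fixes X :: "complex ^ 'm ^ 'm" and Y :: "complex ^ 'm ^ 'n"
  assumes "cadj X ** X = mat 1 + cadj Y ** Y" "X *v v = 0"
  shows "v = 0"
proof -
  have "cdot (vcnj v) ((cadj X ** X) *v v) = 0"
    using assms(2) by (simp add: matrix_vector_mul_assoc[symmetric] cdot_def)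
  moreover have "cdot (vcnj v) ((mat 1 + cadj Y ** Y) *v v) = of_real ((norm v)\<^sup>2 + (norm (Y *v v))\<^sup>2)"
    by (simp add: matrix_vector_mult_add_rdistrib cdot_arith matrix_vector_mul_assoc[symmetric] cdot_cadj cadj_arith cdot_vcnj_self)
  ultimately have "(norm v)\<^sup>2 + (norm (Y *v v))\<^sup>2 = 0"
    using assms(1) by (metis of_real_eq_0_iff)
  then show ?thesis by (simp add: sum_power2_eq_zero_iff)
qed

lemma invertible_A: "invertible A"
  using cadj_self_mult_eq_0[OF block_relations(3)] by (auto simp: invertible_iff_ker)

definition "Ai = matrix_inv A"

text \<open>The Schur complement of \<open>A\<close> in k. It is also the inverse of
  \<open>cadj D\<close>, the form in which \<open>D\<close> enters the harmonic kernel.\<close>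

definition "Di = D - C ** Ai ** B"

text \<open>Obtained by solving for the first half: if k sends (v1, u2) to (u1, v2), this matrix
  sends (u1, u2) to (v1, v2). The invariance |v1|^2 - |u2|^2 = |u1|^2 - |v2|^2 then reads as
  equality of Euclidean norms, which is the source of unitarity.\<close>

definition potapov :: "complex ^ ('p + 'q) ^ ('p + 'q)"
  where "potapov = block Ai (- (Ai ** B)) (C ** Ai) Di"

lemma Ai: "A ** Ai = mat 1" "Ai ** A = mat 1" "A ** (Ai ** X) = X" "Ai ** (A ** X) = X"
  using matrix_inv_invertible[OF invertible_A] by (simp_all add: Ai_def matrix_mul_assoc)

lemma cadj_Ai: "cadj Ai ** cadj A = mat 1" "cadj A ** cadj Ai = mat 1" "cadj Ai ** (cadj A ** X) = X"
  using Ai(1,2) by (simp_all flip: cadj_mult add: cadj_arith matrix_mul_assoc)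

lemma Di: "cadj D ** Di = mat 1" "Di ** cadj D = mat 1" "matrix_inv (cadj D) = Di"
proof -
  have "cadj D ** Di = cadj D ** D - (cadj D ** C) ** Ai ** B"
    by (simp add: Di_def matrix_mult_arith matrix_mul_assoc)
  also have "\<dots> = mat 1"
    by (simp add: block_relations(6) flip: block_relations(5)) (simp add: matrix_mul_assoc[symmetric] Ai)
  finally show "cadj D ** Di = mat 1" .
  then show "Di ** cadj D = mat 1" "matrix_inv (cadj D) = Di"
    by (simp_all add: matrix_left_right_inverse matrix_inv_square_unique)
qed

text \<open>The kernel and \<open>M\<close> write their off-diagonal matrices through
  \<open>D\<close>; these identities turn them into blocks of \<open>potapov\<close>, which are
  written through \<open>A\<close>.\<close>

lemma off_diagonal: "cadj C ** Di = Ai ** B" "Di ** cadj B = C ** Ai"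
proof -
  have "cadj C = Ai ** (B ** cadj D)"
    by (simp flip: block_relations(1) add: Ai)
  then show "cadj C ** Di = Ai ** B"
    by (simp add: matrix_mul_assoc[symmetric] Di)
  have "cadj B = (cadj D ** C) ** Ai"
    by (simp flip: block_relations(5) add: matrix_mul_assoc[symmetric] Ai)
  then show "Di ** cadj B = C ** Ai"
    by (simp add: matrix_mul_assoc Di)
qed

text \<open>The diagonal blocks are the relations for \<open>cadj A ** A\<close> and
  \<open>D ** cadj D\<close>, multiplied on both sides by \<open>Ai\<close> or \<open>Di\<close> and
  their adjoints; the mixed blocks cancel by \<open>off_diagonal\<close>.\<close>

lemma potapov_unitary: "cadj potapov ** potapov = mat 1"
proof -
  have 1: "cadj (C ** Ai) ** Di = cadj Ai ** (Ai ** B)"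
    by (simp add: cadj_mult matrix_mul_assoc[symmetric] off_diagonal)
  have 2: "cadj Di ** (C ** Ai) = cadj (Ai ** B) ** Ai"
    using arg_cong[OF 1, of cadj] by (simp add: cadj_mult cadj_arith matrix_mul_assoc)
  have 3: "cadj Ai ** Ai + cadj (C ** Ai) ** (C ** Ai) = mat 1"
  proof -
    have "cadj Ai ** Ai + cadj (C ** Ai) ** (C ** Ai) = cadj Ai ** ((mat 1 + cadj C ** C) ** Ai)"
      by (simp add: cadj_mult matrix_mult_arith matrix_mul_assoc)
    then show ?thesis
      by (simp add: matrix_mul_assoc[symmetric] Ai cadj_Ai flip: block_relations(3))
  qed
  have 4: "cadj (Ai ** B) ** (Ai ** B) + cadj Di ** Di = mat 1"
  proof -
    have "cadj Di ** D = mat 1"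
      using arg_cong[OF Di(1), of cadj] by (simp add: cadj_mult cadj_arith)
    moreover have "cadj (Ai ** B) ** (Ai ** B) + cadj Di ** Di = cadj Di ** (mat 1 + C ** cadj C) ** Di"
      by (simp flip: off_diagonal(1) add: cadj_mult cadj_arith matrix_mult_arith matrix_mul_assoc add.commute)
    ultimately show ?thesis
      by (simp flip: block_relations(2) add: matrix_mul_assoc Di(1) matrix_mul_assoc[symmetric, of _ "cadj D" Di])
  qed
  show ?thesis
    unfolding potapov_def cadj_block block_mult_block mat_eq_block[where c = 1] block_eq_iff
    by (simp add: cadj_arith matrix_mult_arith 1 2 3 4)
qed

lemma norm_potapov: "norm (potapov *v u) = norm u"
proof -
  have "complex_of_real ((norm (potapov *v u))\<^sup>2) = cdot (vcnj (potapov *v u)) (potapov *v u)"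
    by (simp only: cdot_vcnj_self)
  also have "\<dots> = cdot (vcnj u) (cadj potapov *v (potapov *v u))"
    by (simp add: cdot_cadj cadj_arith)
  also have "\<dots> = of_real ((norm u)\<^sup>2)"
    by (simp only: matrix_vector_mul_assoc potapov_unitary matrix_vector_mul_lid cdot_vcnj_self)
  finally have "(norm (potapov *v u))\<^sup>2 = (norm u)\<^sup>2" by (simp only: of_real_eq_iff)
  then show ?thesis by simp
qed

lemma potapov_eq:
  assumes "A *v v1 + B *v u2 = u1" "C *v v1 + D *v u2 = v2"
  shows "potapov *v vjoin u1 u2 = vjoin v1 v2"
proof -
  have v1: "v1 = Ai *v u1 - (Ai ** B) *v u2"
    unfolding assms(1)[symmetric]
    by (simp add: matrix_vector_right_distrib matrix_vector_mul_assoc Ai)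
  have "v2 = (C ** Ai) *v u1 + Di *v u2"
    unfolding assms(2)[symmetric] v1 Di_def
    by (simp add: matrix_vector_mult_diff_distrib matrix_vector_mult_diff_rdistrib matrix_vector_mul_assoc matrix_mul_assoc)
  with v1 show ?thesis
    by (simp add: potapov_def block_mult_vjoin matrix_vector_mult_uminus)
qed

lemma cadj_potapov_eq:
  assumes "potapov *v u = v"
  shows "cadj potapov *v v = u"
  unfolding assms[symmetric] by (simp add: matrix_vector_mul_assoc potapov_unitary)

text \<open>The polarised exponent of \<^const>\<open>harmonic_kernel\<close> is bilinear in \<open>(w\<^sub>1, z\<^sub>2)\<close>
  and \<open>(z\<^sub>1, w\<^sub>2)\<close> up to conjugations, with the Potapov--Ginzburg transform of \<open>k\<close> as matrix.\<close>

lemma harmonic_kernel_eq: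
  "harmonic_kernel lam (block A B C D) z w = inverse (det A) *
     exp (of_real lam / 2 * cdot (vjoin (vcnj (vfst w)) (vsnd z)) (potapov *v vjoin (vfst z) (vcnj (vsnd w))))"
proof -
  have cD: "mcnj D = transpose (cadj D)" by (simp add: cadj_alt)
  have inv: "matrix_inv (mcnj D) = transpose Di"
    unfolding cD using Di invertible_def by (subst matrix_inv_transpose) auto
  have cB: "mcnj B = transpose (cadj B)" and cC: "mcnj C = transpose (cadj C)" by (simp_all add: cadj_alt)
  have 1: "cdot (matrix_inv (mcnj D) *v (mcnj C *v x)) y = cdot x ((Ai ** B) *v y)" for x y
    unfolding inv cC cdot_transpose off_diagonal(1)[symmetric] matrix_vector_mul_assoc[symmetric] ..
  have 2: "cdot (matrix_inv (mcnj D) *v x) y = cdot x (Di *v y)" for x y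
    unfolding inv cdot_transpose ..
  have 3: "cdot x (mcnj B *v (matrix_inv (mcnj D) *v y)) = cdot y ((C ** Ai) *v x)" for x y
    unfolding inv cB cdot_commute[of x] cdot_transpose off_diagonal(2)[symmetric] matrix_vector_mul_assoc[symmetric] ..
  show ?thesis
    unfolding harmonic_kernel_def Let_def blk_block 1
    unfolding 2 3 Ai_def[symmetric] potapov_def block_mult_vjoin cdot_vjoin
    by (simp add: matrix_vector_mult_uminus cdot_arith cdot_commute[of "Ai *v _"] algebra_simps)
qed

end

section \<open>The kernel of the harmonic representation\<close>

lemma vfst_flip [simp]: "vfst (flip z) = vfst z"
  and vsnd_flip [simp]: "vsnd (flip z) = vcnj (vsnd z)"
  by (simp_all add: flip_def)

lemma norm_flip [simp]: "norm (flip u) = norm u"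
proof -
  have "(norm (flip u))\<^sup>2 = (norm (vjoin (vfst u) (vsnd u)))\<^sup>2"
    unfolding flip_def norm_vjoin by simp
  then show ?thesis by simp
qed

lemma exp_norm_eq: "complex_of_real (exp (- lam * (norm u)\<^sup>2 / 2)) = exp (of_real lam / 2 * (- cdot (vcnj u) u))"
  unfolding cdot_vcnj_self by (simp flip: exp_of_real)

lemma vfst_vcnj [simp]: "vfst (vcnj u) = vcnj (vfst u)"
  and vsnd_vcnj [simp]: "vsnd (vcnj u) = vcnj (vsnd u)"
  by (simp_all add: vec_eq_iff)

lemma block_mult_vec: "block A B C D *v u = vjoin (A *v vfst u + B *v vsnd u) (C *v vfst u + D *v vsnd u)"
  for A :: "'a::semiring_1 ^ 'c::finite ^ 'r::finite" and D :: "'a ^ 'd::finite ^ 's::finite"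
  using block_mult_vjoin[of A B C D "vfst u" "vsnd u"] by simp

lemma holomorphic_vec_coherent: "holomorphic_vec (coherent lam z)"
  unfolding holomorphic_vec_def
proof (intro allI exI conjI)
  fix w :: "complex ^ 'a"
  have "((\<lambda>w. of_real lam * cdot (vcnj z) w / 2) has_derivative (\<lambda>v. of_real lam * cdot (vcnj z) v / 2)) (at w)"
    unfolding cdot_def by (auto intro!: derivative_eq_intros bounded_linear_imp_has_derivative[OF bounded_linear_vec_nth])
  then have "((\<lambda>w. exp (of_real lam * cdot (vcnj z) w / 2)) has_derivative
      (\<lambda>v. exp (of_real lam * cdot (vcnj z) w / 2) * (of_real lam * cdot (vcnj z) v / 2))) (at w)"
    by (rule has_derivative_compose) (use DERIV_exp has_field_derivative_def in blast)
  then show "(coherent lam z has_derivative (\<lambda>v. coherent lam z w * (of_real lam * cdot (vcnj z) v / 2))) (at w)"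
    unfolding coherent_def .
  show "coherent lam z w * (of_real lam * cdot (vcnj z) (c *s v) / 2) = c * (coherent lam z w * (of_real lam * cdot (vcnj z) v / 2))" for c v
    by (simp add: cdot_cmult)
qed

text \<open>\<open>harmonic_rep\<close> is undefined off Fock space, so this must be known before
  the operator can be evaluated at a coherent state.\<close>

lemma coherent_in_fock:
  fixes z :: "complex ^ 'n"
  assumes "lam > 0"
  shows "coherent lam z \<in> fock lam"
proof -
  \<comment> \<open>The squared modulus of the coherent state is the modulus of the exponential of
    twice its exponent, hence the factor 2; with \<open>b = 0\<close> the solution is 0.\<close>
  have "has_bochner_integral (dm lam)
           (\<lambda>u. exp (of_real lam / 2 * (- cdot (vcnj u) (mat 1 *v u) + cdot (2 *s vcnj z) u + cdot 0 (vcnj u))))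
           (inverse (det (mat 1 :: complex ^ 'n ^ 'n)) * exp (of_real lam / 2 * cdot (2 *s vcnj z) 0))"
    by (rule has_bochner_integral_gaussian_dm[where c = 1]) (use assms in \<open>auto simp: cdot_vcnj_self\<close>)
  then have "integrable (dm lam) (\<lambda>u. norm (exp (of_real lam / 2 * (- cdot (vcnj u) (mat 1 *v u) + cdot (2 *s vcnj z) u + cdot 0 (vcnj u)))))"
    by (intro integrable_norm) (simp add: has_bochner_integral_iff)
  also have "(\<lambda>u. norm (exp (of_real lam / 2 * (- cdot (vcnj u) (mat 1 *v u) + cdot (2 *s vcnj z) u + cdot 0 (vcnj u)))))
     = (\<lambda>u. (cmod (coherent lam z u))\<^sup>2 * exp (- lam * (norm u)\<^sup>2 / 2))"
  proof
    fix u :: "complex ^ 'n"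
    have 1: "cdot 0 (vcnj u) = 0" by (simp add: cdot_def)
    have 2: "of_real lam / 2 * (- cdot (vcnj u) (mat 1 *v u) + cdot (2 *s vcnj z) u + cdot 0 (vcnj u))
       = of_real lam * cdot (vcnj z) u / 2 + of_real lam * cdot (vcnj z) u / 2 + of_real (- lam * (norm u)\<^sup>2 / 2)"
      by (simp add: 1 cdot_cmult cdot_vcnj_self field_simps)
    have "norm (exp (complex_of_real (- lam * (norm u)\<^sup>2 / 2))) = exp (- lam * (norm u)\<^sup>2 / 2)"
      by (simp only: norm_exp_eq_Re Re_complex_of_real)
    then show "norm (exp (of_real lam / 2 * (- cdot (vcnj u) (mat 1 *v u) + cdot (2 *s vcnj z) u + cdot 0 (vcnj u))))
      = (cmod (coherent lam z u))\<^sup>2 * exp (- lam * (norm u)\<^sup>2 / 2)"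
      unfolding 2 exp_add norm_mult coherent_def power2_eq_square by simp
  qed
  finally show ?thesis
    using holomorphic_vec_coherent by (simp add: fock_def)
qed

text \<open>Coercivity with constant 1/2 for the unipotent matrices of the next two integrals: the
  cross term is at most |u1| |u2|, which takes at most half of the squares.\<close>

lemma Re_contraction_ge:
  fixes u1 v :: "complex ^ 'm" and u2 :: "complex ^ 'n"
  assumes "norm v \<le> norm u2"
  shows "1 / 2 * ((norm u1)\<^sup>2 + (norm u2)\<^sup>2) \<le> (norm u1)\<^sup>2 + (norm u2)\<^sup>2 + Re (cdot (vcnj u1) v)"
proof -
  have "\<bar>Re (cdot (vcnj u1) v)\<bar> \<le> norm (vcnj u1) * norm v"
    using abs_Re_le_cmod norm_cdot_le order_trans by blast
  also have "\<dots> \<le> norm u1 * norm u2"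
    using assms by (simp add: mult_left_mono)
  also have "\<dots> \<le> 1 / 2 * ((norm u1)\<^sup>2 + (norm u2)\<^sup>2)"
    using sum_squares_bound[of "norm u1" "norm u2"] by simp
  finally have "- Re (cdot (vcnj u1) v) \<le> 1 / 2 * ((norm u1)\<^sup>2 + (norm u2)\<^sup>2)"
    by (simp add: abs_le_iff)
  then show ?thesis by (simp add: field_simps)
qed

text \<open>Reduces equality of integrands to equality of exponents: P belongs to the kernel, Q to
  the coherent state, R to the Gaussian weight.\<close>

lemma exp_half_combine:
  fixes l :: complex
  assumes "P + Q - R = K + X"
  shows "c * exp (l / 2 * K) * exp (l / 2 * X) = c * exp (l / 2 * P) * exp (l * Q / 2) * exp (l / 2 * (- R))"
proof -
  have "l / 2 * K + l / 2 * X = l / 2 * (P + Q - R)"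
    unfolding assms by (simp add: distrib_left)
  also have "\<dots> = l / 2 * P + l * Q / 2 + l / 2 * (- R)"
    by (simp add: algebra_simps add_divide_distrib diff_divide_distrib)
  finally show ?thesis
    by (simp only: mult.assoc exp_add[symmetric] add.assoc)
qed

context su_block
begin

text \<open>Blocks of a unitary matrix are contractions: apply it to a vector with one half zero and
  discard one half of the image.\<close>

lemma norm_potapov_le:
  "norm (Ai ** B *v v) \<le> norm v" "norm (C ** Ai *v u) \<le> norm u"
proof -
  have "(norm (Ai ** B *v v))\<^sup>2 \<le> (norm (potapov *v vjoin 0 v))\<^sup>2"
    by (simp add: potapov_def block_mult_vjoin norm_vjoin matrix_vector_mult_uminus del: norm_potapov)
  also have "\<dots> = (norm v)\<^sup>2"
    unfolding norm_potapov norm_vjoin by simp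
  finally show "norm (Ai ** B *v v) \<le> norm v" by simp
  have "(norm (C ** Ai *v u))\<^sup>2 \<le> (norm (potapov *v vjoin u 0))\<^sup>2"
    by (simp add: potapov_def block_mult_vjoin norm_vjoin del: norm_potapov)
  also have "\<dots> = (norm u)\<^sup>2"
    unfolding norm_potapov norm_vjoin by simp
  finally show "norm (C ** Ai *v u) \<le> norm u" by simp
qed

text \<open>In the integration variable the kernel is quadratic only through the block
  \<open>Ai ** B\<close>. After \<open>flip\<close> the matrix \<open>H\<close> is therefore upper
  unipotent and contributes determinant 1.\<close>

lemma integral_kernel_coherent:
  assumes lam: "lam > 0"
  shows "(\<integral>u. harmonic_kernel lam (block A B C D) z u * coherent lam w u * of_real (exp (- lam * (norm u)\<^sup>2 / 2)) \<partial>dm lam)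
    = harmonic_kernel lam (block A B C D) z w"
proof -
  define H where "H = block (mat 1) (Ai ** B) 0 (mat 1 :: complex ^ 'q ^ 'q)"
  define b where "b = vjoin (Ai *v vfst z) (vcnj (vsnd w))"
  define a where "a = vjoin (vcnj (vfst w)) (transpose Di *v vsnd z)"
  \<comment> \<open>Back substitution in the upper triangular system
    \<open>H *v x = b\<close>.\<close>
  define x where "x = vjoin (Ai *v vfst z - Ai ** B *v vcnj (vsnd w)) (vcnj (vsnd w))"
  define K where "K = cdot (vsnd z) (C ** Ai *v vfst z)"
  have quad: "cdot (vcnj u) (H *v u) = cdot (vcnj u) u + cdot (vcnj (vfst u)) (Ai ** B *v vsnd u)" for u
    by (simp add: H_def block_mult_vec cdot_vfst_vsnd cdot_arith)
  have "1 / 2 * (norm u)\<^sup>2 \<le> Re (cdot (vcnj u) (H *v u))" for u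
    using Re_contraction_ge[OF norm_potapov_le(1)[of "vsnd u"], of "vfst u"] norm_vjoin[of "vfst u" "vsnd u"]
    unfolding quad cdot_vcnj_self by simp
  then have "has_bochner_integral (dm lam)
           (\<lambda>u. exp (of_real lam / 2 * (- cdot (vcnj u) (H *v u) + cdot a u + cdot b (vcnj u))))
           (inverse (det H) * exp (of_real lam / 2 * cdot a x))"
    by (rule has_bochner_integral_gaussian_dm[OF lam, rotated])
      (simp_all add: H_def x_def b_def block_mult_vjoin)
  then have "has_bochner_integral (dm lam)
           (\<lambda>u. inverse (det A) * exp (of_real lam / 2 * K) * exp (of_real lam / 2 * (- cdot (vcnj u) (H *v u) + cdot a u + cdot b (vcnj u))))
           (inverse (det A) * exp (of_real lam / 2 * K) * (inverse (det H) * exp (of_real lam / 2 * cdot a x)))"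
    by (intro has_bochner_integral_mult_right)
  also have "(\<lambda>u. inverse (det A) * exp (of_real lam / 2 * K) * exp (of_real lam / 2 * (- cdot (vcnj u) (H *v u) + cdot a u + cdot b (vcnj u))))
     = (\<lambda>u. harmonic_kernel lam (block A B C D) z (flip u) * coherent lam w (flip u) * of_real (exp (- lam * (norm (flip u))\<^sup>2 / 2)))"
  proof
    fix u
    have "cdot (vjoin (vcnj (vfst u)) (vsnd z)) (potapov *v vjoin (vfst z) (vsnd u)) + cdot (vcnj w) (flip u) - cdot (vcnj u) u
      = K + (- cdot (vcnj u) (H *v u) + cdot a u + cdot b (vcnj u))"
      unfolding quad K_def
      by (simp add: potapov_def block_mult_vec cdot_vfst_vsnd cdot_arith matrix_vector_mult_uminus
          a_def b_def cdot_transpose cdot_commute[of "Ai *v _"] cdot_commute[of "vcnj (vsnd w)"] del: transpose_matrix_vector)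
    then show "inverse (det A) * exp (of_real lam / 2 * K) * exp (of_real lam / 2 * (- cdot (vcnj u) (H *v u) + cdot a u + cdot b (vcnj u)))
      = harmonic_kernel lam (block A B C D) z (flip u) * coherent lam w (flip u) * of_real (exp (- lam * (norm (flip u))\<^sup>2 / 2))"
      unfolding harmonic_kernel_eq coherent_def exp_norm_eq norm_flip
      by (simp only: vfst_flip vsnd_flip vcnj_arith exp_half_combine)
  qed
  finally have "has_bochner_integral (dm lam) (\<lambda>u. harmonic_kernel lam (block A B C D) z u * coherent lam w u * of_real (exp (- lam * (norm u)\<^sup>2 / 2)))
     (inverse (det A) * exp (of_real lam / 2 * K) * (inverse (det H) * exp (of_real lam / 2 * cdot a x)))"
    by (rule has_bochner_integral_dm_flip)
  moreover have "K + cdot a x = cdot (vjoin (vcnj (vfst w)) (vsnd z)) (potapov *v vjoin (vfst z) (vcnj (vsnd w)))"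
    by (simp add: K_def potapov_def block_mult_vec cdot_vfst_vsnd cdot_arith matrix_vector_mult_uminus
        a_def x_def cdot_transpose del: transpose_matrix_vector)
  then have "exp (of_real lam / 2 * K) * exp (of_real lam / 2 * cdot a x)
     = exp (of_real lam / 2 * cdot (vjoin (vcnj (vfst w)) (vsnd z)) (potapov *v vjoin (vfst z) (vcnj (vsnd w))))"
    by (simp only: exp_add[symmetric] distrib_left[symmetric])
  ultimately show ?thesis
    by (simp add: has_bochner_integral_iff harmonic_kernel_eq H_def det_block_upper_unit mult.assoc)
qed

text \<open>Mirror image of the preceding integral: in its first argument the kernel is quadratic
  through \<open>C ** Ai\<close>, so \<open>H\<close> is lower unipotent.\<close>

lemma fock_inner_kernel_coherent:
  assumes lam: "lam > 0"
  shows "fock_inner lam (\<lambda>u. harmonic_kernel lam (block A B C D) u w) (coherent lam z)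
    = harmonic_kernel lam (block A B C D) z w"
proof -
  define H where "H = block (mat 1 :: complex ^ 'p ^ 'p) 0 (- (C ** Ai)) (mat 1)"
  define b where "b = vjoin (vfst z) (Di *v vcnj (vsnd w))"
  define a where "a = vjoin (transpose Ai *v vcnj (vfst w)) (vsnd z)"
  define x where "x = vjoin (vfst z) (Di *v vcnj (vsnd w) + C ** Ai *v vfst z)"
  define K where "K = - cdot (vcnj (vfst w)) (Ai ** B *v vcnj (vsnd w))"
  have quad: "cdot (vcnj u) (H *v u) = cdot (vcnj u) u + cdot (vcnj (vsnd u)) (- (C ** Ai *v vfst u))" for u
    by (simp add: H_def block_mult_vec cdot_vfst_vsnd cdot_arith matrix_vector_mult_uminus)
  have "1 / 2 * (norm u)\<^sup>2 \<le> Re (cdot (vcnj u) (H *v u))" for u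
    using Re_contraction_ge[of "- (C ** Ai *v vfst u)" "vfst u" "vsnd u"] norm_vjoin[of "vfst u" "vsnd u"]
      norm_potapov_le(2)[of "vfst u"]
    unfolding quad cdot_vcnj_self by (simp add: add.commute)
  then have "has_bochner_integral (dm lam)
           (\<lambda>u. exp (of_real lam / 2 * (- cdot (vcnj u) (H *v u) + cdot a u + cdot b (vcnj u))))
           (inverse (det H) * exp (of_real lam / 2 * cdot a x))"
    by (rule has_bochner_integral_gaussian_dm[OF lam, rotated])
      (simp_all add: H_def x_def b_def block_mult_vjoin matrix_vector_mult_uminus)
  then have "has_bochner_integral (dm lam)
           (\<lambda>u. inverse (det A) * exp (of_real lam / 2 * K) * exp (of_real lam / 2 * (- cdot (vcnj u) (H *v u) + cdot a u + cdot b (vcnj u))))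
           (inverse (det A) * exp (of_real lam / 2 * K) * (inverse (det H) * exp (of_real lam / 2 * cdot a x)))"
    by (intro has_bochner_integral_mult_right)
  also have "(\<lambda>u. inverse (det A) * exp (of_real lam / 2 * K) * exp (of_real lam / 2 * (- cdot (vcnj u) (H *v u) + cdot a u + cdot b (vcnj u))))
     = (\<lambda>u. harmonic_kernel lam (block A B C D) (flip u) w * cnj (coherent lam z (flip u)) * of_real (exp (- lam * (norm (flip u))\<^sup>2 / 2)))"
  proof
    fix u
    have "cdot (vjoin (vcnj (vfst w)) (vcnj (vsnd u))) (potapov *v vjoin (vfst u) (vcnj (vsnd w))) + cdot z (vcnj (flip u)) - cdot (vcnj u) u
      = K + (- cdot (vcnj u) (H *v u) + cdot a u + cdot b (vcnj u))"
      unfolding quad K_def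
      by (simp add: potapov_def block_mult_vec cdot_vfst_vsnd cdot_arith matrix_vector_mult_uminus
          a_def b_def cdot_transpose cdot_commute[of "Di *v _"] del: transpose_matrix_vector)
    then show "inverse (det A) * exp (of_real lam / 2 * K) * exp (of_real lam / 2 * (- cdot (vcnj u) (H *v u) + cdot a u + cdot b (vcnj u)))
      = harmonic_kernel lam (block A B C D) (flip u) w * cnj (coherent lam z (flip u)) * of_real (exp (- lam * (norm (flip u))\<^sup>2 / 2))"
      unfolding harmonic_kernel_eq coherent_def exp_norm_eq norm_flip
      by (simp only: vfst_flip vsnd_flip vcnj_arith exp_cnj complex_cnj_mult complex_cnj_divide complex_cnj_complex_of_real
          complex_cnj_numeral cnj_cdot exp_half_combine)
  qed
  finally have "has_bochner_integral (dm lam) (\<lambda>u. harmonic_kernel lam (block A B C D) u w * cnj (coherent lam z u) * of_real (exp (- lam * (norm u)\<^sup>2 / 2)))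
     (inverse (det A) * exp (of_real lam / 2 * K) * (inverse (det H) * exp (of_real lam / 2 * cdot a x)))"
    by (rule has_bochner_integral_dm_flip)
  moreover have "K + cdot a x = cdot (vjoin (vcnj (vfst w)) (vsnd z)) (potapov *v vjoin (vfst z) (vcnj (vsnd w)))"
    by (simp add: K_def potapov_def block_mult_vec cdot_vfst_vsnd cdot_arith matrix_vector_mult_uminus
        a_def x_def cdot_transpose del: transpose_matrix_vector)
  then have "exp (of_real lam / 2 * K) * exp (of_real lam / 2 * cdot a x)
     = exp (of_real lam / 2 * cdot (vjoin (vcnj (vfst w)) (vsnd z)) (potapov *v vjoin (vfst z) (vcnj (vsnd w))))"
    by (simp only: exp_add[symmetric] distrib_left[symmetric])
  ultimately show ?thesis
    unfolding fock_inner_def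
    by (simp add: has_bochner_integral_iff harmonic_kernel_eq H_def det_block_lower_unit mult.assoc)
qed

lemma op_kernel_harmonic_rep:
  assumes lam: "lam > 0"
  shows "op_kernel lam (harmonic_rep lam (block A B C D)) z w = harmonic_kernel lam (block A B C D) z w"
  unfolding op_kernel_def harmonic_rep_def
  by (simp only: restrict_apply coherent_in_fock[OF lam] if_True integral_kernel_coherent[OF lam]
      fock_inner_kernel_coherent[OF lam])

section \<open>The matrix of the Weyl integral\<close>

text \<open>Multiplication by \<open>J0\<close>, the K of the overview. It arises because the kernel
  is evaluated at (z + w, z - w): the half of each kernel vector taken from the second argument
  moves with the opposite sign.\<close>

definition neg_snd :: "complex ^ ('p + 'q) \<Rightarrow> complex ^ ('p + 'q)"
  where "neg_snd u = vjoin (vfst u) (- vsnd u)"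

lemma neg_snd_arith: "neg_snd (u + v) = neg_snd u + neg_snd v" "neg_snd (u - v) = neg_snd u - neg_snd v" "neg_snd (neg_snd u) = u" "vcnj (neg_snd u) = neg_snd (vcnj u)"
  by (simp_all add: neg_snd_def vjoin_arith vcnj_vjoin)

lemma cdot_neg_snd: "cdot (neg_snd u) v = cdot u (neg_snd v)"
  by (simp add: neg_snd_def cdot_vfst_vsnd cdot_arith)

lemma norm_neg_snd [simp]: "norm (neg_snd u) = norm u"
proof -
  have "(norm (neg_snd u))\<^sup>2 = (norm (vjoin (vfst u) (vsnd u)))\<^sup>2"
    unfolding neg_snd_def norm_vjoin by simp
  then show ?thesis by simp
qed

definition gauss_mat :: "complex ^ ('p + 'q) ^ ('p + 'q)"
  where "gauss_mat = block (mat 1 + Ai) (Ai ** B) (- (C ** Ai)) (mat 1 + Di)"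

lemma gauss_mat_vec: "gauss_mat *v u = u + neg_snd (potapov *v neg_snd u)"
  by (simp add: gauss_mat_def potapov_def neg_snd_def block_mult_vec matrix_vector_mult_uminus
      matrix_vector_mult_add_rdistrib vec_eq_iff_Plus)

text \<open>Block row operations on k + 1: the first row is multiplied by \<open>Ai\<close>, then
  \<open>C\<close> times the result is subtracted from the second row.\<close>

lemma gauss_mat_eq: "gauss_mat = block Ai 0 (- (C ** Ai)) (mat 1) ** (block A B C D + mat 1)"
proof -
  have "block A B C D + mat 1 = block (A + mat 1) B C (D + mat 1)"
    by (simp add: vec_eq_iff_Plus mat_def)
  then show ?thesis
    by (simp add: gauss_mat_def block_mult_block block_eq_iff matrix_mult_arith Ai matrix_mul_assoc[symmetric] Di_def algebra_simps)
qed

lemma det_gauss_mat: "det A * det gauss_mat = det (block A B C D + mat 1)"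
proof -
  have "block Ai 0 (- (C ** Ai)) (mat 1) = block (mat 1) 0 (- C) (mat 1) ** block Ai 0 0 (mat 1)"
    by (simp add: block_mult_block matrix_mult_arith)
  then have "det (block Ai 0 (- (C ** Ai)) (mat 1 :: complex ^ 'q ^ 'q)) = det Ai"
    by (simp add: det_mul det_block_lower_unit det_block_diag_one)
  moreover have "det A * det Ai = 1"
    by (simp flip: det_mul add: Ai)
  ultimately show ?thesis
    unfolding gauss_mat_eq det_mul by simp
qed

text \<open>\<open>gauss_mat\<close> is the identity plus an isometry V, and |u + V u|^2 = 2 |u|^2 +
  2 Re <V u, u>.\<close>

lemma Re_gauss_mat: "Re (cdot (vcnj u) (gauss_mat *v u)) = (norm (gauss_mat *v u))\<^sup>2 / 2"
proof -
  define v where "v = neg_snd (potapov *v neg_snd u)"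
  have v: "norm v = norm u" by (simp add: v_def norm_potapov)
  have "complex_of_real ((norm (u + v))\<^sup>2) = cdot (vcnj u) u + cdot (vcnj u) v + cdot (vcnj v) u + cdot (vcnj v) v"
    unfolding cdot_vcnj_self[symmetric] by (simp add: cdot_arith)
  also have "cdot (vcnj v) u = cnj (cdot (vcnj u) v)"
    by (simp add: cnj_cdot cdot_commute)
  finally have "Re (complex_of_real ((norm (u + v))\<^sup>2)) = Re (cdot (vcnj u) u + cdot (vcnj u) v + cnj (cdot (vcnj u) v) + cdot (vcnj v) v)"
    by (rule arg_cong)
  then have "(norm (u + v))\<^sup>2 = 2 * (norm u)\<^sup>2 + 2 * Re (cdot (vcnj u) v)"
    by (simp add: cdot_vcnj_self v)
  then show ?thesis
    unfolding gauss_mat_vec v_def[symmetric] by (simp add: cdot_arith cdot_vcnj_self)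
qed

lemma Re_gauss_mat_ge:
  assumes "det (block A B C D + mat 1) \<noteq> 0"
  obtains c where "c > 0" "\<And>u. c * (norm u)\<^sup>2 \<le> Re (cdot (vcnj u) (gauss_mat *v u))"
proof -
  have "det gauss_mat \<noteq> 0" using assms det_gauss_mat by force
  then have "invertible gauss_mat" by (simp add: invertible_det_nz)
  then obtain G where G: "G ** gauss_mat = mat 1" unfolding invertible_def by auto
  obtain K where K: "K > 0" "\<And>v. norm (G *v v) \<le> norm v * K"
    using bounded_linear.pos_bounded[OF matrix_vector_mul_bounded_linear[of G]] by auto
  \<comment> \<open>\<open>K\<close> bounds the inverse of \<open>gauss_mat\<close>, so |u| is at
    most K |H u|; the further 2 comes from \<open>Re_gauss_mat\<close>.\<close>
  have "1 / (2 * K\<^sup>2) * (norm u)\<^sup>2 \<le> Re (cdot (vcnj u) (gauss_mat *v u))" for u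
  proof -
    have "norm u \<le> norm (gauss_mat *v u) * K"
      using K(2)[of "gauss_mat *v u"] by (simp add: matrix_vector_mul_assoc G)
    then have "(norm u)\<^sup>2 \<le> (norm (gauss_mat *v u) * K)\<^sup>2"
      by (intro power_mono) auto
    then show ?thesis
      unfolding Re_gauss_mat using K(1) by (simp add: field_simps power_mult_distrib)
  qed
  moreover have "1 / (2 * K\<^sup>2) > 0" using K(1) by simp
  ultimately show ?thesis using that by blast
qed

end

section \<open>The Weyl symbol\<close>

context su_block
begin

text \<open>k sends \<sigma> to \<zeta> - \<sigma>; exchanging the first halves of argument and
  value gives the action of \<open>potapov\<close>.\<close>

lemma potapov_half:
  assumes "block A B C D *v \<sigma> + \<sigma> = \<zeta>"
  shows "potapov *v vjoin (vfst \<zeta> - vfst \<sigma>) (vsnd \<sigma>) = vjoin (vfst \<sigma>) (vsnd \<zeta> - vsnd \<sigma>)"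
  by (rule potapov_eq) (auto simp: assms[symmetric] block_mult_vec)

text \<open>The vector \<open>neg_snd x + \<zeta>\<close> is twice the argument in
  \<open>potapov_half\<close>, which is what singles out x = \<zeta> - 2 \<sigma>.\<close>

lemma gauss_mat_solution:
  assumes \<sigma>: "block A B C D *v \<sigma> + \<sigma> = \<zeta>"
  defines "x \<equiv> \<zeta> - \<sigma> - \<sigma>"
  shows "gauss_mat *v x = neg_snd \<zeta> - neg_snd (potapov *v \<zeta>)" and "potapov *v (neg_snd x + \<zeta>) = \<zeta> - neg_snd x"
proof -
  define y where "y = vjoin (vfst \<zeta> - vfst \<sigma>) (vsnd \<sigma>)"
  have "neg_snd x + \<zeta> = y + y"
    by (simp add: x_def y_def neg_snd_def vec_eq_iff_Plus)
  then have "potapov *v (neg_snd x + \<zeta>) = vjoin (vfst \<sigma>) (vsnd \<zeta> - vsnd \<sigma>) + vjoin (vfst \<sigma>) (vsnd \<zeta> - vsnd \<sigma>)"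
    by (simp only: y_def matrix_vector_right_distrib potapov_half[OF \<sigma>])
  also have "\<dots> = \<zeta> - neg_snd x"
    by (simp add: x_def neg_snd_def vec_eq_iff_Plus)
  finally show 1: "potapov *v (neg_snd x + \<zeta>) = \<zeta> - neg_snd x" .
  then have "potapov *v neg_snd x = \<zeta> - neg_snd x - potapov *v \<zeta>"
    by (simp add: matrix_vector_right_distrib algebra_simps)
  then show "gauss_mat *v x = neg_snd \<zeta> - neg_snd (potapov *v \<zeta>)"
    unfolding gauss_mat_vec by (simp add: neg_snd_arith)
qed

lemma weyl_harmonic_rep:
  assumes lam: "lam > 0" and det: "det (block A B C D + mat 1) \<noteq> 0"
    and \<sigma>: "block A B C D *v \<sigma> + \<sigma> = flip z"
  shows "weyl lam (harmonic_rep lam (block A B C D)) z = 2 ^ CARD('p + 'q) * inverse (det (block A B C D + mat 1)) *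
     exp (- of_real lam * cdot (vcnj (flip z)) (neg_snd (flip z - \<sigma> - \<sigma>)))"
proof -
  define \<zeta> where "\<zeta> = flip z"
  define x where "x = \<zeta> - \<sigma> - \<sigma>"
  \<comment> \<open>\<open>b\<close>, \<open>a\<close> and \<open>K\<close> collect the terms of the
    Weyl exponent that are linear in \<open>cnj u\<close>, linear in \<open>u\<close>, and
    constant.\<close>
  define b where "b = neg_snd \<zeta> - neg_snd (potapov *v \<zeta>)"
  define a where "a = neg_snd (transpose potapov *v vcnj \<zeta>) - neg_snd (vcnj \<zeta>)"
  define K where "K = cdot (vcnj \<zeta>) (potapov *v \<zeta>) - cdot (vcnj \<zeta>) \<zeta>"
  obtain c where c: "c > 0" "\<And>u. c * (norm u)\<^sup>2 \<le> Re (cdot (vcnj u) (gauss_mat *v u))"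
    using Re_gauss_mat_ge[OF det] by blast
  have sol: "gauss_mat *v x = b" "potapov *v (neg_snd x + \<zeta>) = \<zeta> - neg_snd x"
    using gauss_mat_solution[OF \<sigma>] by (simp_all add: x_def b_def \<zeta>_def)
  have a: "cdot a u = cdot (vcnj \<zeta>) (potapov *v neg_snd u) - cdot (vcnj \<zeta>) (neg_snd u)" for u
    by (simp add: a_def cdot_arith cdot_neg_snd cdot_transpose del: transpose_matrix_vector)
  have "has_bochner_integral (dm lam)
           (\<lambda>u. exp (of_real lam / 2 * (- cdot (vcnj u) (gauss_mat *v u) + cdot a u + cdot b (vcnj u))))
           (inverse (det gauss_mat) * exp (of_real lam / 2 * cdot a x))"
    by (rule has_bochner_integral_gaussian_dm[OF lam c sol(1)])
  then have "has_bochner_integral (dm lam)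
           (\<lambda>u. inverse (det A) * exp (of_real lam / 2 * K) * exp (of_real lam / 2 * (- cdot (vcnj u) (gauss_mat *v u) + cdot a u + cdot b (vcnj u))))
           (inverse (det A) * exp (of_real lam / 2 * K) * (inverse (det gauss_mat) * exp (of_real lam / 2 * cdot a x)))"
    by (intro has_bochner_integral_mult_right)
  also have "(\<lambda>u. inverse (det A) * exp (of_real lam / 2 * K) * exp (of_real lam / 2 * (- cdot (vcnj u) (gauss_mat *v u) + cdot a u + cdot b (vcnj u))))
     = (\<lambda>u. harmonic_kernel lam (block A B C D) (z + flip u) (z - flip u) * exp (of_real lam / 2 *
         (- cdot z (vcnj z) - cdot (flip u) (vcnj (flip u)) + cdot z (vcnj (flip u)) - cdot (vcnj z) (flip u))))"
  proof
    fix u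
    have 1: "vjoin (vcnj (vfst (z - flip u))) (vsnd (z + flip u)) = vcnj \<zeta> - neg_snd (vcnj u)"
      "vjoin (vfst (z + flip u)) (vcnj (vsnd (z - flip u))) = \<zeta> + neg_snd u"
      by (simp_all add: \<zeta>_def flip_def neg_snd_def vcnj_vjoin vjoin_arith)
    have 2: "- cdot z (vcnj z) - cdot (flip u) (vcnj (flip u)) + cdot z (vcnj (flip u)) - cdot (vcnj z) (flip u)
       = - cdot (vcnj \<zeta>) \<zeta> - cdot (vcnj u) u + cdot (neg_snd \<zeta>) (vcnj u) - cdot (vcnj \<zeta>) (neg_snd u)"
      by (simp add: \<zeta>_def cdot_vfst_vsnd neg_snd_def cdot_arith
          cdot_commute[of "vfst z" "vcnj (vfst z)"] cdot_commute[of "vfst u" "vcnj (vfst u)"] algebra_simps)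
    have "cdot (vcnj \<zeta> - neg_snd (vcnj u)) (potapov *v (\<zeta> + neg_snd u)) + (- cdot (vcnj \<zeta>) \<zeta> - cdot (vcnj u) u + cdot (neg_snd \<zeta>) (vcnj u) - cdot (vcnj \<zeta>) (neg_snd u))
       = K + (- cdot (vcnj u) (gauss_mat *v u) + cdot a u + cdot b (vcnj u))"
      unfolding a by (simp add: K_def b_def gauss_mat_vec cdot_arith matrix_vector_right_distrib cdot_neg_snd
          cdot_commute[of "potapov *v \<zeta>"] cdot_commute[of \<zeta>] neg_snd_arith algebra_simps)
    then have 3: "of_real lam / 2 * K + of_real lam / 2 * (- cdot (vcnj u) (gauss_mat *v u) + cdot a u + cdot b (vcnj u))
       = of_real lam / 2 * cdot (vcnj \<zeta> - neg_snd (vcnj u)) (potapov *v (\<zeta> + neg_snd u)) + of_real lam / 2 * (- cdot (vcnj \<zeta>) \<zeta> - cdot (vcnj u) u + cdot (neg_snd \<zeta>) (vcnj u) - cdot (vcnj \<zeta>) (neg_snd u))"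
      unfolding distrib_left[symmetric] by simp
    show "inverse (det A) * exp (of_real lam / 2 * K) * exp (of_real lam / 2 * (- cdot (vcnj u) (gauss_mat *v u) + cdot a u + cdot b (vcnj u)))
     = harmonic_kernel lam (block A B C D) (z + flip u) (z - flip u) * exp (of_real lam / 2 *
         (- cdot z (vcnj z) - cdot (flip u) (vcnj (flip u)) + cdot z (vcnj (flip u)) - cdot (vcnj z) (flip u)))"
      unfolding harmonic_kernel_eq 1 2 mult.assoc exp_add[symmetric] 3 ..
  qed
  finally have "has_bochner_integral (dm lam) (\<lambda>w. harmonic_kernel lam (block A B C D) (z + w) (z - w) * exp (of_real lam / 2 *
         (- cdot z (vcnj z) - cdot w (vcnj w) + cdot z (vcnj w) - cdot (vcnj z) w)))
     (inverse (det A) * exp (of_real lam / 2 * K) * (inverse (det gauss_mat) * exp (of_real lam / 2 * cdot a x)))"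
    by (rule has_bochner_integral_dm_flip)
  then have "weyl lam (harmonic_rep lam (block A B C D)) z
     = 2 ^ CARD('p + 'q) * (inverse (det A) * exp (of_real lam / 2 * K) * (inverse (det gauss_mat) * exp (of_real lam / 2 * cdot a x)))"
    unfolding weyl_def op_kernel_harmonic_rep[OF lam] by (simp only: has_bochner_integral_iff)
  also have "\<dots> = 2 ^ CARD('p + 'q) * inverse (det A * det gauss_mat) * exp (of_real lam / 2 * K + of_real lam / 2 * cdot a x)"
    by (simp only: exp_add inverse_mult_distrib mult_ac)
  also have "of_real lam / 2 * K + of_real lam / 2 * cdot a x = - of_real lam * cdot (vcnj \<zeta>) (neg_snd x)"
  proof -
    \<comment> \<open>Constant and linear terms combine into potapov - 1 applied to
      \<open>neg_snd x + \<zeta>\<close>, whose image under \<open>potapov\<close> is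
      \<open>\<zeta> - neg_snd x\<close>.\<close>
    have "K + cdot a x = cdot (vcnj \<zeta>) (potapov *v (neg_snd x + \<zeta>)) - cdot (vcnj \<zeta>) (neg_snd x + \<zeta>)"
      unfolding a by (simp add: K_def cdot_arith matrix_vector_right_distrib)
    also have "\<dots> = - 2 * cdot (vcnj \<zeta>) (neg_snd x)"
      unfolding sol(2) by (simp add: cdot_arith)
    finally show ?thesis
      unfolding distrib_left[symmetric] by simp
  qed
  finally show ?thesis
    unfolding det_gauss_mat by (simp add: x_def \<zeta>_def)
qed

text \<open>Norm preservation in \<open>potapov_half\<close> gives |\<zeta>1 - s1|^2 + |s2|^2 =
  |s1|^2 + |\<zeta>2 - s2|^2. The squares of s1 and s2 cancel, and the rest eliminates the terms
  quadratic in \<zeta>. The resulting pairing is a number minus its conjugate, so the exponent is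
  purely imaginary.\<close>

lemma exponent_eq:
  assumes \<sigma>: "block A B C D *v \<sigma> + \<sigma> = flip z"
  shows "- cdot (vcnj (flip z)) (neg_snd (flip z - \<sigma> - \<sigma>)) = cdot (vcnj z) (flip \<sigma>) - cdot z (vcnj (flip \<sigma>))"
proof -
  define s1 s2 t1 t2 where "s1 = vfst \<sigma>" and "s2 = vsnd \<sigma>" and "t1 = vfst z" and "t2 = vcnj (vsnd z)"
  have "cdot (vcnj (vjoin (t1 - s1) s2)) (vjoin (t1 - s1) s2) = cdot (vcnj (vjoin s1 (t2 - s2))) (vjoin s1 (t2 - s2))"
    using norm_potapov[of "vjoin (t1 - s1) s2"] potapov_half[OF \<sigma>]
    unfolding cdot_vcnj_self by (simp add: s1_def s2_def t1_def t2_def)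
  then have eq: "cdot (vcnj t1) t1 - cdot (vcnj t1) s1 - cdot (vcnj s1) t1 = cdot (vcnj t2) t2 - cdot (vcnj t2) s2 - cdot (vcnj s2) t2"
    by (simp add: vcnj_vjoin cdot_vjoin cdot_arith algebra_simps)
  have z: "z = vjoin t1 (vcnj t2)" "\<sigma> = vjoin s1 s2"
    by (simp_all add: s1_def s2_def t1_def t2_def)
  have fz: "flip z = vjoin t1 t2" by (simp add: z flip_def)
  have e1: "cdot (vcnj (flip z)) (neg_snd (flip z - \<sigma> - \<sigma>)) = cdot (vcnj t1) t1 - cdot (vcnj t1) s1 - cdot (vcnj t1) s1
      - (cdot (vcnj t2) t2 - cdot (vcnj t2) s2 - cdot (vcnj t2) s2)"
    unfolding fz z(2)
    by (simp only: neg_snd_def vfst_arith vsnd_arith vfst_vjoin vsnd_vjoin vcnj_vjoin cdot_vjoin cdot_arith add_uminus_conv_diff)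
  have e2: "cdot (vcnj z) (flip \<sigma>) - cdot z (vcnj (flip \<sigma>))
      = cdot (vcnj t1) s1 + cdot (vcnj s2) t2 - cdot (vcnj s1) t1 - cdot (vcnj t2) s2"
    by (simp add: z flip_def vcnj_vjoin cdot_vjoin cdot_commute[of t1 "vcnj s1"] cdot_commute[of t2 "vcnj s2"])
  show ?thesis
    unfolding e1 e2 using eq by (simp add: algebra_simps)
qed

abbreviation "kk \<equiv> block A B C D"

lemma M_mat_eq: "M_mat kk = block
    (block 0 (- transpose (C ** Ai)) (- (C ** Ai)) 0) (block (mat 1 + transpose Ai) 0 0 (mat 1 + Di))
    (block (mat 1 + Ai) 0 0 (mat 1 + transpose Di)) (block 0 (Ai ** B) (transpose (Ai ** B)) 0)"
proof -
  have cD: "mcnj D = transpose (cadj D)" by (simp add: cadj_alt)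
  have invD: "matrix_inv (mcnj D) = transpose Di"
    unfolding cD using Di invertible_def by (subst matrix_inv_transpose) auto
  have invA: "matrix_inv (transpose A) = transpose Ai"
    using invertible_A by (simp add: matrix_inv_transpose Ai_def)
  have cB: "mcnj B = transpose (cadj B)" and cC: "mcnj C = transpose (cadj C)" by (simp_all add: cadj_alt)
  have "mcnj B ** matrix_inv (mcnj D) = transpose (C ** Ai)" "matrix_inv (mcnj D) ** mcnj C = transpose (Ai ** B)"
    unfolding invD cB cC matrix_transpose_mul[symmetric] off_diagonal by simp_all
  then show ?thesis
    by (simp add: M_mat_def R_mat_def S_mat_def T_mat_def Let_def invA Di(3) off_diagonal transpose_block transpose_add transpose_zero)
qed

end

section \<open>The two forms of the exponent\<close>

lemma cdot_mat: "cdot u (mat c *v v) = c * cdot u v"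
proof -
  have "mat c *v v = c *s v"
    by (simp add: vec_eq_iff matrix_vector_mult_def mat_def mult_delta_left)
  then show ?thesis by (simp add: cdot_cmult)
qed

lemma mcnj_cadj: "mcnj (cadj X) = transpose X"
  by (simp add: vec_eq_iff cadj_def mcnj_def transpose_def)

lemma mcnj_mcnj [simp]: "mcnj (mcnj X) = X"
  by (simp add: vec_eq_iff mcnj_def)

lemma mcnj_zero [simp]: "mcnj 0 = 0"
  by (simp add: vec_eq_iff mcnj_def)

context su_block
begin

lemma M_mat_vec: "M_mat kk *v vjoin (vjoin a1 a2) (vjoin b1 b2) = vjoin
    (vjoin (b1 + transpose Ai *v b1 - transpose (C ** Ai) *v a2) (b2 + Di *v b2 - C ** Ai *v a1))
    (vjoin (a1 + Ai *v a1 + Ai ** B *v b2) (a2 + transpose Di *v a2 + transpose (Ai ** B) *v b1))"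
  unfolding M_mat_eq
  by (simp add: block_mult_vjoin vjoin_arith matrix_vector_mult_uminus matrix_vector_mult_add_rdistrib del: transpose_matrix_vector)

lemma transpose_M_mat: "transpose (M_mat kk) = M_mat kk"
  by (simp add: M_mat_eq transpose_block transpose_uminus transpose_add transpose_zero)

text \<open>Up to a permutation of rows and columns \<open>M\<close> is the direct sum of
  \<open>gauss_mat\<close>, acting on (a1, b2), and its transpose, acting on (b1, a2).\<close>

lemma invertible_M_mat:
  assumes "det (kk + mat 1) \<noteq> 0"
  shows "invertible (M_mat kk)"
  unfolding invertible_iff_ker
proof (intro allI impI)
  fix r assume r: "M_mat kk *v r = 0"
  define a1 a2 b1 b2 where "a1 = vfst (vfst r)" and "a2 = vsnd (vfst r)" and "b1 = vfst (vsnd r)" and "b2 = vsnd (vsnd r)"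
  have r_eq: "r = vjoin (vjoin a1 a2) (vjoin b1 b2)"
    by (simp add: a1_def a2_def b1_def b2_def)
  have eqs: "b1 + transpose Ai *v b1 - transpose (C ** Ai) *v a2 = 0" "b2 + Di *v b2 - C ** Ai *v a1 = 0"
    "a1 + Ai *v a1 + Ai ** B *v b2 = 0" "a2 + transpose Di *v a2 + transpose (Ai ** B) *v b1 = 0"
    using r unfolding r_eq M_mat_vec vjoin_eq_0_iff by blast+
  have det: "det gauss_mat \<noteq> 0" using assms det_gauss_mat by force
  then have inv: "invertible gauss_mat" "invertible (transpose gauss_mat)"
    by (simp_all add: invertible_det_nz)
  have "gauss_mat *v vjoin a1 b2 = 0"
    unfolding gauss_mat_def block_mult_vjoin vjoin_eq_0_iff using eqs(2,3)
    by (simp add: matrix_vector_mult_add_rdistrib matrix_vector_mult_uminus)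
  then have "vjoin a1 b2 = 0" using inv(1) unfolding invertible_iff_ker by blast
  moreover have "transpose gauss_mat *v vjoin b1 a2 = 0"
    unfolding gauss_mat_def transpose_block block_mult_vjoin vjoin_eq_0_iff transpose_add transpose_uminus transpose_mat
    using eqs(1,4)
    by (simp add: matrix_vector_mult_add_rdistrib matrix_vector_mult_uminus add.commute del: transpose_matrix_vector)
  then have "vjoin b1 a2 = 0" using inv(2) unfolding invertible_iff_ker by blast
  ultimately show "r = 0" by (simp add: r_eq vjoin_eq_0_iff)
qed

text \<open>A preimage under \<open>M\<close> in place of its inverse. The second and third block
  rows are \<open>potapov_half\<close>; the first and fourth are the same relation inverted by
  unitarity and then conjugated.\<close>

lemma M_mat_solution:
  assumes \<sigma>: "kk *v \<sigma> + \<sigma> = flip z"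
  shows "M_mat kk *v vjoin (z - flip \<sigma>) (- vcnj (flip \<sigma>)) = vjoin (- vcnj z) z"
proof -
  define s1 s2 y1 y2 where "s1 = vfst \<sigma>" and "s2 = vsnd \<sigma>" and "y1 = vfst z - s1" and "y2 = vcnj (vsnd z) - s2"
  have U: "potapov *v vjoin y1 s2 = vjoin s1 y2"
    using potapov_half[OF \<sigma>] by (simp add: s1_def s2_def y1_def y2_def)
  then have 1: "Ai *v y1 - Ai ** B *v s2 = s1" "C ** Ai *v y1 + Di *v s2 = y2"
    by (simp_all add: potapov_def block_mult_vjoin matrix_vector_mult_uminus)
  have "cadj Ai *v s1 + cadj (C ** Ai) *v y2 = y1" "cadj Di *v y2 - cadj (Ai ** B) *v s1 = s2"
    using cadj_potapov_eq[OF U]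
    by (simp_all add: potapov_def cadj_block cadj_arith block_mult_vjoin matrix_vector_mult_uminus)
  from this[THEN arg_cong[of _ _ vcnj]]
  have 2: "transpose Ai *v vcnj s1 + transpose (C ** Ai) *v vcnj y2 = vcnj y1"
    "transpose Di *v vcnj y2 - transpose (Ai ** B) *v vcnj s1 = vcnj s2"
    by (simp_all add: vcnj_matrix_vector mcnj_cadj del: transpose_matrix_vector)
  have z: "z = vjoin (y1 + s1) (vcnj y2 + vcnj s2)" and \<sigma>_eq: "\<sigma> = vjoin s1 s2"
    by (simp_all add: s1_def s2_def y1_def y2_def)
  have "vjoin (z - flip \<sigma>) (- vcnj (flip \<sigma>)) = vjoin (vjoin y1 (vcnj y2)) (vjoin (- vcnj s1) (- s2))"
    by (simp add: z \<sigma>_eq flip_def vjoin_arith vcnj_vjoin)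
  moreover have "vjoin (- vcnj z) z = vjoin (vjoin (- vcnj y1 - vcnj s1) (- y2 - s2)) (vjoin (y1 + s1) (vcnj y2 + vcnj s2))"
    by (simp add: z vcnj_vjoin vjoin_arith)
  moreover have "M_mat kk *v vjoin (vjoin y1 (vcnj y2)) (vjoin (- vcnj s1) (- s2))
      = vjoin (vjoin (- vcnj y1 - vcnj s1) (- y2 - s2)) (vjoin (y1 + s1) (vcnj y2 + vcnj s2))"
    unfolding M_mat_vec vjoin_eq_iff using 1 2
    by (simp add: matrix_vector_mult_uminus algebra_simps del: transpose_matrix_vector)
  ultimately show ?thesis by metis
qed

text \<open>The form is that of the inverse of \<open>M\<close> at (- cnj z, z), plus |z|^2 from the
  two blocks 1/2; \<open>M_mat_solution\<close> evaluates it.\<close>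

lemma exponent_M_mat:
  assumes det: "det (kk + mat 1) \<noteq> 0" and \<sigma>: "kk *v \<sigma> + \<sigma> = flip z"
  shows "cdot (vjoin z (vcnj z))
          (block (gamma_mat kk) (mat (1/2) - transpose (beta_mat kk)) (mat (1/2) - beta_mat kk) (alpha_mat kk) *v vjoin z (vcnj z))
     = cdot (vcnj z) (flip \<sigma>) - cdot z (vcnj (flip \<sigma>))"
proof -
  let ?G = "matrix_inv (M_mat kk)"
  have inv: "invertible (M_mat kk)" by (rule invertible_M_mat[OF det])
  have "transpose ?G = ?G"
    using matrix_inv_transpose[OF inv] by (simp add: transpose_M_mat)
  then have "blk21 ?G = transpose (beta_mat kk)"
    by (metis beta_mat_def block_blk blk_block(3) transpose_block)
  then have G: "?G = block (alpha_mat kk) (beta_mat kk) (transpose (beta_mat kk)) (gamma_mat kk)"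
    by (metis alpha_mat_def beta_mat_def gamma_mat_def block_blk)
  have "?G *v vjoin (- vcnj z) z = vjoin (z - flip \<sigma>) (- vcnj (flip \<sigma>))"
    unfolding M_mat_solution[OF \<sigma>, symmetric]
    by (simp add: matrix_vector_mul_assoc matrix_inv_invertible[OF inv])
  then have 1: "beta_mat kk *v z - alpha_mat kk *v vcnj z = z - flip \<sigma>"
    "gamma_mat kk *v z - transpose (beta_mat kk) *v vcnj z = - vcnj (flip \<sigma>)"
    unfolding G block_mult_vjoin by (simp_all add: matrix_vector_mult_uminus del: transpose_matrix_vector)
  have "cdot (vjoin z (vcnj z))
          (block (gamma_mat kk) (mat (1/2) - transpose (beta_mat kk)) (mat (1/2) - beta_mat kk) (alpha_mat kk) *v vjoin z (vcnj z))
     = cdot z (gamma_mat kk *v z - transpose (beta_mat kk) *v vcnj z) + cdot z (vcnj z)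
       - cdot (vcnj z) (beta_mat kk *v z - alpha_mat kk *v vcnj z)"
    by (simp add: block_mult_vjoin cdot_vjoin matrix_vector_mult_diff_rdistrib cdot_arith cdot_mat cdot_commute[of z "vcnj z"] del: transpose_matrix_vector)
  also have "\<dots> = cdot (vcnj z) (flip \<sigma>) - cdot z (vcnj (flip \<sigma>))"
    unfolding 1 by (simp add: cdot_arith cdot_commute[of z "vcnj z"])
  finally show ?thesis .
qed

section \<open>The Cayley transform of the doubled matrix\<close>

text \<open>For v = w this is (flip v, cnj (flip v)), the shape of (z, cnj z). Independent
  \<open>v\<close> and \<open>w\<close> reach every vector of the doubled space, as a kernel
  argument for \<open>k_tilde + 1\<close> requires.\<close>

definition interleave :: "complex ^ ('p + 'q) \<Rightarrow> complex ^ ('p + 'q) \<Rightarrow> complex ^ (('p + 'q) + ('p + 'q))"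
  where "interleave v w = vjoin (vjoin (vfst v) (vcnj (vsnd w))) (vjoin (vcnj (vfst w)) (vsnd v))"

text \<open>Up to a permutation of coordinates, \<^const>\<open>k_tilde\<close> is the direct sum of \<open>k\<close> and its conjugate.\<close>

lemma k_tilde_interleave: "k_tilde kk *v interleave v w = interleave (kk *v v) (kk *v w)"
  by (simp add: k_tilde_def P_mat_def Q_mat_def interleave_def mcnj_block block_mult_vec vjoin_arith vcnj_matrix_vector add.commute)

lemma interleave_arith: "interleave v w + interleave v' w' = interleave (v + v') (w + w')"
  by (simp add: interleave_def vjoin_arith)

lemma interleave_same: "interleave v v = vjoin (flip v) (vcnj (flip v))"
  by (simp add: interleave_def flip_def vcnj_vjoin)

lemma interleave_eq_0_iff: "interleave v w = 0 \<longleftrightarrow> v = 0 \<and> w = 0"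
  by (auto simp: interleave_def vec_eq_iff split_sum_all)

lemma invertible_k_tilde:
  assumes "det (kk + mat 1) \<noteq> 0"
  shows "invertible (k_tilde kk + mat 1)"
  unfolding invertible_iff_ker
proof (intro allI impI)
  fix r assume r: "(k_tilde kk + mat 1) *v r = 0"
  define v w where "v = vjoin (vfst (vfst r)) (vsnd (vsnd r))" and "w = vcnj (vjoin (vfst (vsnd r)) (vsnd (vfst r)))"
  have r_eq: "r = interleave v w"
    by (simp add: v_def w_def interleave_def)
  have "interleave ((kk + mat 1) *v v) ((kk + mat 1) *v w) = 0"
    using r by (simp add: r_eq matrix_vector_mult_add_rdistrib k_tilde_interleave interleave_arith)
  then have "(kk + mat 1) *v v = 0" "(kk + mat 1) *v w = 0"
    by (simp_all add: interleave_eq_0_iff)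
  moreover have "invertible (kk + mat 1)"
    using assms by (simp add: invertible_det_nz)
  ultimately have "v = 0" "w = 0" unfolding invertible_iff_ker by blast+
  then show "r = 0" by (simp add: r_eq interleave_eq_0_iff)
qed

text \<open>(z, cnj z) is the image of (flip \<sigma>, cnj (flip \<sigma>)) under
  \<open>k_tilde + 1\<close>. The factor 2 compensates lam / 2 in place of lam in front of this
  form.\<close>

lemma exponent_k_tilde:
  assumes det: "det (kk + mat 1) \<noteq> 0" and \<sigma>: "kk *v \<sigma> + \<sigma> = flip z"
  shows "cdot (vjoin z (vcnj z)) ((symp_J ** matrix_inv (k_tilde kk + mat 1) ** (k_tilde kk - mat 1)) *v vjoin z (vcnj z))
     = 2 * (cdot (vcnj z) (flip \<sigma>) - cdot z (vcnj (flip \<sigma>)))"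
proof -
  let ?Z = "vjoin z (vcnj z)" and ?s = "vjoin (flip \<sigma>) (vcnj (flip \<sigma>))"
  let ?K = "matrix_inv (k_tilde kk + mat 1)"
  have K: "?K *v ((k_tilde kk + mat 1) *v r) = r" for r
    using matrix_inv_invertible(2)[OF invertible_k_tilde[OF det]] by (simp add: matrix_vector_mul_assoc)
  have Z: "?Z = (k_tilde kk + mat 1) *v ?s"
    using \<sigma> by (simp flip: interleave_same add: matrix_vector_mult_add_rdistrib k_tilde_interleave interleave_arith)
      (simp add: interleave_same)
  \<comment> \<open>Writing k_tilde - 1 as (k_tilde + 1) - 2 lets the inverse act on known images
    only.\<close>
  have "(k_tilde kk - mat 1) *v ?Z = (k_tilde kk + mat 1) *v ?Z - ?Z - ?Z"
    by (simp only: matrix_vector_mult_diff_rdistrib matrix_vector_mult_add_rdistrib matrix_vector_mul_lid) simp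
  then have "?K *v ((k_tilde kk - mat 1) *v ?Z) = ?Z - ?s - ?s"
    using K[of ?s] K[of ?Z] by (simp only: matrix_vector_mult_diff_distrib flip: Z)
  then have "(symp_J ** ?K ** (k_tilde kk - mat 1)) *v ?Z = symp_J *v (?Z - ?s - ?s)"
    by (simp only: matrix_vector_mul_assoc[symmetric])
  also have "\<dots> = vjoin (vcnj z - vcnj (flip \<sigma>) - vcnj (flip \<sigma>)) (- (z - flip \<sigma> - flip \<sigma>))"
    by (simp only: symp_J_def vjoin_arith block_mult_vjoin matrix_vector_mult_uminus matrix_vector_mult_0 matrix_vector_mul_lid add_0_left add_0_right)
  finally have 1: "(symp_J ** ?K ** (k_tilde kk - mat 1)) *v ?Z = vjoin (vcnj z - vcnj (flip \<sigma>) - vcnj (flip \<sigma>)) (- (z - flip \<sigma> - flip \<sigma>))" .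
  have "cdot ?Z ((symp_J ** ?K ** (k_tilde kk - mat 1)) *v ?Z)
     = cdot z (vcnj z) - cdot z (vcnj (flip \<sigma>)) - cdot z (vcnj (flip \<sigma>))
       - (cdot (vcnj z) z - cdot (vcnj z) (flip \<sigma>) - cdot (vcnj z) (flip \<sigma>))"
    unfolding 1 by (simp only: cdot_vjoin cdot_arith add_uminus_conv_diff)
  then show ?thesis
    by (simp add: cdot_commute[of z "vcnj z"])
qed

end

text \<open>The integrals yield 1 / (det A * det H) = 1 / det (k + 1) as a complex number, so the
  prefactor keeps the sign of this real determinant, and an absolute value would be wrong when it is
  negative.\<close>

theorem theorem4p5:
  fixes lam :: real
    and k :: "complex ^ ('p::finite + 'q::finite) ^ ('p + 'q)"
    and z :: "complex ^ ('p + 'q)"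
  assumes "lam > 0"
    and "k \<in> SU"
    and "det (k + mat 1) \<noteq> 0"
  shows "weyl lam (harmonic_rep lam k) z =
      2 ^ CARD('p + 'q) * inverse (det (k + mat 1)) *
      exp (of_real lam *
        cdot (vjoin z (vcnj z))
          (block (gamma_mat k) (mat (1/2) - transpose (beta_mat k))
                 (mat (1/2) - beta_mat k) (alpha_mat k)
            *v vjoin z (vcnj z)))
    \<and>
      2 ^ CARD('p + 'q) * inverse (det (k + mat 1)) *
      exp (of_real lam *
        cdot (vjoin z (vcnj z))
          (block (gamma_mat k) (mat (1/2) - transpose (beta_mat k))
                 (mat (1/2) - beta_mat k) (alpha_mat k)
            *v vjoin z (vcnj z))) =
      2 ^ CARD('p + 'q) * inverse (det (k + mat 1)) *
      exp (of_real lam / 2 *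
        cdot (vjoin z (vcnj z))
          ((symp_J ** matrix_inv (k_tilde k + mat 1) ** (k_tilde k - mat 1))
            *v vjoin z (vcnj z)))"
proof -
  define A B C D where "A = blk11 k" and "B = blk12 k" and "C = blk21 k" and "D = blk22 k"
  have k: "k = block A B C D" by (simp add: A_def B_def C_def D_def)
  interpret su_block A B C D
    using assms(2) unfolding k by unfold_locales
  \<comment> \<open>Solvability of the equation for \<sigma>, on which all three exponent formulas
    rest.\<close>
  have "invertible (k + mat 1)" using assms(3) by (simp add: invertible_det_nz)
  then obtain G where "(k + mat 1) ** G = mat 1" unfolding invertible_def by auto
  then have "(k + mat 1) *v (G *v flip z) = flip z"
    by (simp add: matrix_vector_mul_assoc)
  then obtain \<sigma> where \<sigma>: "block A B C D *v \<sigma> + \<sigma> = flip z"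
    by (metis k matrix_vector_mult_add_rdistrib matrix_vector_mul_lid)
  note det = assms(3)[unfolded k]
  have "- of_real lam * cdot (vcnj (flip z)) (neg_snd (flip z - \<sigma> - \<sigma>)) = of_real lam * (cdot (vcnj z) (flip \<sigma>) - cdot z (vcnj (flip \<sigma>)))"
    unfolding exponent_eq[OF \<sigma>, symmetric] by simp
  moreover have "of_real lam / 2 * (2 * X) = of_real lam * X" for X :: complex by simp
  ultimately show ?thesis
    unfolding k exponent_M_mat[OF det \<sigma>] exponent_k_tilde[OF det \<sigma>] weyl_harmonic_rep[OF assms(1) det \<sigma>]
    by (simp only: simp_thms)
qed

end
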